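(* Let $R$ be a finite commutative local ring with maximal ideal $\mathfrak m\neq 0$. Let $p_1,\ldots,p_r$ consist of exactly one element from each class of associates of elements of $\mathfrak m\setminus\mathfrak m^2$, and for $1\le i\le r$ let $\mathfrak a_i=\{a\in R\mid ap_i=0\}$ be the annihilator ideal of $p_i$. Then in the Gabriel quiver $Q(\mathbb C\mathrm{Aff}(R))$: (1) there is an arrow from the trivial module $\mathbb C$ to $W_{(\mathcal O,1)}$, where $\mathcal O$ is the orbit of a character $\chi\colon R\to\mathbb C^{\times}$ with $\mathfrak m\subseteq\ker\chi\subsetneq R$ and $1$ is the trivial character of $\mathrm{St}_{U(R)}(\chi)$; (2) for each $1\le i\le r$, if $\mathcal O$ is the orbit of a character $\chi\in\widehat R$ with $\mathfrak a_i\subseteq\ker\chi$ and $\rho$ is a character of $\mathrm{St}_{U(R)}(\chi)$ with $1+\mathfrak a_i\subseteq\ker\rho$, then there is one arrow from $W_{(\mathcal O,\rho)}$ to each simple module $W_{(\mathcal O',\rho')}$ such that $\mathcal O'$ is the orbit of a character $\chi'\in\widehat R$ with $\chi'(p_ia)=\chi(a)$ for all $a\in R$ and $\rho|_{\mathrm{St}_{U(R)}(\chi')}=\rho'$ (where $\mathrm{St}_{U(R)}(\chi')\subseteq\mathrm{St}_{U(R)}(\chi)$). Arrows arising from different choices of $i$ are counted as different arrows, so multiple edges can arise from different choices of $i$.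
   Context: All rings are unital. For a finite commutative ring $R$, $\mathrm{Aff}(R)$ is the monoid of all maps $R\to R$, $x\mapsto ax+b$ with $a,b\in R$ (as formal pairs $(a,b)$, equivalently as maps), under composition: $(ax+b)\circ(cx+d)=acx+ad+b$. $U(R)$ is the group of units of $R$, and $U(\mathrm{Aff}(R))=\{ax+b\mid a\in U(R),b\in R\}\cong R\rtimes U(R)$ is the group of units of $\mathrm{Aff}(R)$. Two elements $a,b\in R$ are associates if $a=ub$ with $u\in U(R)$. $\mathfrak m^2$ is the square of the ideal $\mathfrak m$. The Gabriel quiver $Q(A)$ of a finite dimensional $\mathbb C$-algebra $A$ has as vertices the isomorphism classes of simple left $A$-modules, and the number of arrows from $[S]$ to $[S']$ is $\dim_{\mathbb C}\mathrm{Ext}^1_A(S,S')$. $\widehat R=\mathrm{Hom}((R,+),\mathbb C^\times)$ is the group of characters of the additive group of $R$; $U(R)$ acts on it by $(u\chi)(a)=\chi(ua)$, "orbit" means $U(R)$-orbit, and $\mathrm{St}_{U(R)}(\chi)$ is the stabilizer of $\chi$ (it depends only on the orbit of $\chi$, since $U(R)$ is abelian). For an orbit $\mathcal O$, $\chi\in\mathcal O$, and a degree one character $\rho\colon\mathrm{St}_{U(R)}(\chi)\to\mathbb C^\times$, put $$W_{(\mathcal O,\rho)}=\mathrm{Ind}^{U(\mathrm{Aff}(R))}_{R\rtimes\mathrm{St}_{U(R)}(\chi)}\chi\otimes\rho,\qquad (\chi\otimes\rho)(ax+b)=\chi(b)\rho(a).$$ Up to isomorphism this does not depend on the choice of $\chi\in\mathcal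 O$, and these modules form a complete irredundant list of simple $\mathbb CU(\mathrm{Aff}(R))$-modules. For $R$ local with maximal ideal $\mathfrak m$, the simple $\mathbb C\mathrm{Aff}(R)$-modules are, up to isomorphism: the trivial module $\mathbb C$, on which every element of $\mathrm{Aff}(R)$ acts as the identity; and the modules $W_{(\mathcal O,\rho)}$, regarded as $\mathbb C\mathrm{Aff}(R)$-modules by letting every element of $\mathrm{Aff}(R)\setminus U(\mathrm{Aff}(R))$ (i.e. every $ax+b$ with $a\in\mathfrak m$) act as $0$. In particular the trivial module $\mathbb C$ is distinct from the trivial $U(\mathrm{Aff}(R))$-module extended by zero. The characters $\chi\in\widehat R$ with $\mathfrak m\subseteq\ker\chi\subsetneq R$ form a single $U(R)$-orbit. *)

theory Defs
  imports Complex_Main "HOL-Library.Poly_Mapping" "HOL-Library.Extended_Nat"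
begin

section \<open>Finite commutative local rings\<close>

definition is_ideal :: "'r::comm_ring_1 set \<Rightarrow> bool" where
  "is_ideal I \<longleftrightarrow> 0 \<in> I \<and> (\<forall>x\<in>I. \<forall>y\<in>I. x + y \<in> I) \<and> (\<forall>a. \<forall>x\<in>I. a * x \<in> I)"

definition is_maximal_ideal :: "'r::comm_ring_1 set \<Rightarrow> bool" where
  "is_maximal_ideal I \<longleftrightarrow>
     is_ideal I \<and> I \<noteq> UNIV \<and> (\<forall>J. is_ideal J \<and> I \<subseteq> J \<longrightarrow> J = I \<or> J = UNIV)"

text \<open>The ring is local and its unique maximal ideal is \<open>\<mm>\<close>.\<close>

definition local_ring_with :: "'r::comm_ring_1 set \<Rightarrow> bool" where
  "local_ring_with \<mm> \<longleftrightarrow> (\<forall>I. is_maximal_ideal I \<longleftrightarrow> I = \<mm>)"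

text \<open>The square of an ideal: the ideal generated by the products, not just the set of products.\<close>

definition ideal_square :: "'r::comm_ring_1 set \<Rightarrow> 'r set" where
  "ideal_square I = \<Inter>{J. is_ideal J \<and> (\<forall>x\<in>I. \<forall>y\<in>I. x * y \<in> J)}"

definition associates :: "'r::comm_ring_1 \<Rightarrow> 'r \<Rightarrow> bool" where
  "associates a b \<longleftrightarrow> (\<exists>u. u dvd 1 \<and> a = u * b)"

definition annihilator :: "'r::comm_ring_1 \<Rightarrow> 'r set" where
  "annihilator p = {a. a * p = 0}"


section \<open>Characters\<close>

definition add_character :: "('r::comm_ring_1 \<Rightarrow> complex) \<Rightarrow> bool" where
  "add_character \<chi> \<longleftrightarrow> (\<forall>a. \<chi> a \<noteq> 0) \<and> (\<forall>a b. \<chi> (a + b) = \<chi> a * \<chi> b)"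

definition char_ker :: "('r::comm_ring_1 \<Rightarrow> complex) \<Rightarrow> 'r set" where
  "char_ker \<chi> = {a. \<chi> a = 1}"

definition char_orbit :: "('r::comm_ring_1 \<Rightarrow> complex) \<Rightarrow> ('r \<Rightarrow> complex) set" where
  "char_orbit \<chi> = {\<lambda>a. \<chi> (u * a) | u. u dvd 1}"

definition char_stab :: "('r::comm_ring_1 \<Rightarrow> complex) \<Rightarrow> 'r set" where
  "char_stab \<chi> = {u. u dvd 1 \<and> (\<forall>a. \<chi> (u * a) = \<chi> a)}"

text \<open>Degree one characters of a group \<open>H\<close> of units; values outside \<open>H\<close> are irrelevant.\<close>

definition mult_character_on :: "'r::comm_ring_1 set \<Rightarrow> ('r \<Rightarrow> complex) \<Rightarrow> bool" where
  "mult_character_on H \<rho> \<longleftrightarrow>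
     (\<forall>u\<in>H. \<rho> u \<noteq> 0) \<and> (\<forall>u\<in>H. \<forall>v\<in>H. \<rho> (u * v) = \<rho> u * \<rho> v)"


section \<open>The affine monoid and its algebra\<close>

text \<open>
  \<open>Aff a b\<close> is the formal map \<open>x \<mapsto> a x + b\<close>. The library's monoid algebra, finitely supported
  functions under convolution (type \<open>_ \<Rightarrow>\<^sub>0 complex\<close>), expects the (not necessarily commutative)
  monoid to be written additively. Hence composition of affine maps is written \<open>+\<close> and the
  identity map is \<open>0\<close>. The algebra of the affine monoid over the complex numbers is
  \<open>'r aff \<Rightarrow>\<^sub>0 complex\<close>.
\<close>

datatype 'r aff = Aff (slope: 'r) (shift: 'r)

instantiation aff :: (comm_ring_1) monoid_add
begin

definition zero_aff :: "'a aff" where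
  "zero_aff = Aff 1 0"

definition plus_aff :: "'a aff \<Rightarrow> 'a aff \<Rightarrow> 'a aff" where
  "plus_aff f g = Aff (slope f * slope g) (slope f * shift g + shift f)"

instance
  by standard (auto simp: zero_aff_def plus_aff_def algebra_simps)

end

definition aff_units :: "'r::comm_ring_1 aff set" where
  "aff_units = {Aff a b | a b. a dvd 1}"


section \<open>Left modules over a ring\<close>

text \<open>
  A left module is a subset of some abelian group together with an action; the behaviour of the
  action outside the carrier is irrelevant.
\<close>

record ('a, 'v) lmodule =
  car :: "'v set"
  act :: "'a \<Rightarrow> 'v \<Rightarrow> 'v"

definition left_module :: "('a::ring_1, 'v::ab_group_add) lmodule \<Rightarrow> bool" where
  "left_module M \<longleftrightarrow>
     0 \<in> car M \<and>
     (\<forall>x\<in>car M. \<forall>y\<in>car M. x + y \<in> car M) \<and>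
     (\<forall>a. \<forall>x\<in>car M. act M a x \<in> car M) \<and>
     (\<forall>a. \<forall>x\<in>car M. \<forall>y\<in>car M. act M a (x + y) = act M a x + act M a y) \<and>
     (\<forall>a b. \<forall>x\<in>car M. act M (a + b) x = act M a x + act M b x) \<and>
     (\<forall>a b. \<forall>x\<in>car M. act M (a * b) x = act M a (act M b x)) \<and>
     (\<forall>x\<in>car M. act M 1 x = x)"

definition submodule :: "'v set \<Rightarrow> ('a::ring_1, 'v::ab_group_add) lmodule \<Rightarrow> bool" where
  "submodule N M \<longleftrightarrow>
     N \<subseteq> car M \<and> 0 \<in> N \<and> (\<forall>x\<in>N. \<forall>y\<in>N. x + y \<in> N) \<and> (\<forall>a. \<forall>x\<in>N. act M a x \<in> N)"

definition simple_module :: "('a::ring_1, 'v::ab_group_add) lmodule \<Rightarrow> bool" where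
  "simple_module M \<longleftrightarrow>
     left_module M \<and> car M \<noteq> {0} \<and> (\<forall>N. submodule N M \<longrightarrow> N = {0} \<or> N = car M)"

text \<open>Homomorphisms are normalised to vanish outside the carrier, so that equality of functions is
  equality of homomorphisms.\<close>

definition module_homs ::
  "('a::ring_1, 'v::ab_group_add) lmodule \<Rightarrow> ('a, 'w::ab_group_add) lmodule \<Rightarrow> ('v \<Rightarrow> 'w) set" where
  "module_homs M N =
     {h. (\<forall>x\<in>car M. h x \<in> car N) \<and>
         (\<forall>x\<in>car M. \<forall>y\<in>car M. h (x + y) = h x + h y) \<and>
         (\<forall>a. \<forall>x\<in>car M. h (act M a x) = act N a (h x)) \<and>
         (\<forall>x. x \<notin> car M \<longrightarrow> h x = 0)}"


section \<open>The first Ext group and the Gabriel quiver\<close>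

text \<open>
  Let \<open>F\<close> be the free module on the underlying set of \<open>M\<close>, \<open>\<epsilon> : F \<rightarrow> M\<close> the canonical surjection
  and \<open>K\<close> its kernel. Then \<open>Ext\<^sup>1(M, N)\<close> is the cokernel of the restriction map
  \<open>Hom(F, N) \<rightarrow> Hom(K, N)\<close>.
\<close>

definition free_cover ::
  "('a::ring_1, 'v::ab_group_add) lmodule \<Rightarrow> ('a, 'v \<Rightarrow>\<^sub>0 'a) lmodule" where
  "free_cover M =
     \<lparr>car = {f. Poly_Mapping.keys f \<subseteq> car M}, act = (\<lambda>a. Poly_Mapping.map (\<lambda>b. a * b))\<rparr>"

definition cover_map :: "('a::ring_1, 'v::ab_group_add) lmodule \<Rightarrow> ('v \<Rightarrow>\<^sub>0 'a) \<Rightarrow> 'v" where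
  "cover_map M f = (\<Sum>v\<in>Poly_Mapping.keys f. act M (Poly_Mapping.lookup f v) v)"

definition syzygy ::
  "('a::ring_1, 'v::ab_group_add) lmodule \<Rightarrow> ('a, 'v \<Rightarrow>\<^sub>0 'a) lmodule" where
  "syzygy M =
     \<lparr>car = {f \<in> car (free_cover M). cover_map M f = 0}, act = act (free_cover M)\<rparr>"

definition restricted_homs ::
  "('a::ring_1, 'v::ab_group_add) lmodule \<Rightarrow> ('a, 'w::ab_group_add) lmodule
     \<Rightarrow> (('v \<Rightarrow>\<^sub>0 'a) \<Rightarrow> 'w) set" where
  "restricted_homs M N =
     {\<lambda>f. if f \<in> car (syzygy M) then g f else 0 | g. g \<in> module_homs (free_cover M) N}"

text \<open>
  For a monoid algebra over the complex numbers, the scalar \<open>c\<close> is the algebra element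
  \<open>Poly_Mapping.single 0 c\<close>. The dimension of the complex vector space \<open>Ext\<^sup>1(M, N)\<close> is the supremum
  of the sizes of the finite subsets of \<open>Hom(K, N)\<close> that are linearly independent modulo the image
  of \<open>Hom(F, N)\<close>.
\<close>

definition ext1_independent ::
  "('m::monoid_add \<Rightarrow>\<^sub>0 complex, 'v::ab_group_add) lmodule
     \<Rightarrow> ('m \<Rightarrow>\<^sub>0 complex, 'w::ab_group_add) lmodule
     \<Rightarrow> (('v \<Rightarrow>\<^sub>0 'm \<Rightarrow>\<^sub>0 complex) \<Rightarrow> 'w) set \<Rightarrow> bool" where
  "ext1_independent M N B \<longleftrightarrow>
     finite B \<and> B \<subseteq> module_homs (syzygy M) N \<and>
     (\<forall>c. (\<lambda>f. \<Sum>h\<in>B. act N (Poly_Mapping.single 0 (c h)) (h f)) \<in> restricted_homs M N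
        \<longrightarrow> (\<forall>h\<in>B. c h = 0))"

definition ext1_dim ::
  "('m::monoid_add \<Rightarrow>\<^sub>0 complex, 'v::ab_group_add) lmodule
     \<Rightarrow> ('m \<Rightarrow>\<^sub>0 complex, 'w::ab_group_add) lmodule \<Rightarrow> enat" where
  "ext1_dim M N = (SUP B\<in>{B. ext1_independent M N B}. enat (card B))"

text \<open>
  The number of arrows \<open>[S] \<rightarrow> [S']\<close> in the Gabriel quiver. Vertices are given by representatives,
  which must be simple: for modules that are not vertices there are no arrows.
\<close>

definition gabriel_arrows ::
  "('m::monoid_add \<Rightarrow>\<^sub>0 complex, 'v::ab_group_add) lmodule
     \<Rightarrow> ('m \<Rightarrow>\<^sub>0 complex, 'w::ab_group_add) lmodule \<Rightarrow> enat" where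
  "gabriel_arrows S S' = (if simple_module S \<and> simple_module S' then ext1_dim S S' else 0)"


section \<open>The simple modules of the affine monoid\<close>

definition trivial_module :: "('r::comm_ring_1 aff \<Rightarrow>\<^sub>0 complex, complex) lmodule" where
  "trivial_module =
     \<lparr>car = UNIV,
      act = (\<lambda>a z. \<Sum>g\<in>Poly_Mapping.keys a. Poly_Mapping.lookup a g * z)\<rparr>"

text \<open>
  The representation of the unit group \<open>G\<close> induced from a degree one character \<open>\<psi>\<close> of a subgroup
  \<open>H\<close>, in the usual model of functions \<open>f\<close> on \<open>G\<close> with \<open>f(gh) = \<psi>(h)\<^sup>-\<^sup>1 f(g)\<close>, on which \<open>g \<in> G\<close> acts
  by \<open>(g f)(x) = f(g\<^sup>-\<^sup>1 x)\<close>; this action is convolution with \<open>g\<close> on the left. It is extended to the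
  whole monoid by letting all elements outside \<open>G\<close> act as zero.
\<close>

definition induced_module ::
  "'r::comm_ring_1 aff set \<Rightarrow> ('r aff \<Rightarrow> complex)
     \<Rightarrow> ('r aff \<Rightarrow>\<^sub>0 complex, 'r aff \<Rightarrow>\<^sub>0 complex) lmodule" where
  "induced_module H \<psi> =
     \<lparr>car = {f. Poly_Mapping.keys f \<subseteq> aff_units \<and>
               (\<forall>g\<in>aff_units. \<forall>h\<in>H.
                  \<psi> h * Poly_Mapping.lookup f (g + h) = Poly_Mapping.lookup f g)},
      act = (\<lambda>a f. \<Sum>g\<in>Poly_Mapping.keys a \<inter> aff_units.
               Poly_Mapping.single g (Poly_Mapping.lookup a g) * f)\<rparr>"

text \<open>The module \<open>W\<close> attached to the orbit of \<open>\<chi>\<close> and the character \<open>\<rho>\<close> of its stabilizer.\<close>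

definition W_module ::
  "('r::comm_ring_1 \<Rightarrow> complex) \<Rightarrow> ('r \<Rightarrow> complex)
     \<Rightarrow> ('r aff \<Rightarrow>\<^sub>0 complex, 'r aff \<Rightarrow>\<^sub>0 complex) lmodule" where
  "W_module \<chi> \<rho> =
     induced_module {Aff a b | a b. a \<in> char_stab \<chi>} (\<lambda>g. \<chi> (shift g) * \<rho> (slope g))"

end

theory Submission
  imports Defs
begin

text \<open>
  Let \<open>M\<close> and \<open>N\<close> be modules over the algebra of a monoid. A family of linear maps
  \<open>D g : M \<rightarrow> N\<close> with \<open>D (gh) = g (D h) + (D g) h\<close> makes \<open>N \<oplus> M\<close> an extension of \<open>M\<close> by \<open>N\<close>, on which \<open>g\<close>
  acts by \<open>(n, m) \<mapsto> (g n + D g m, g m)\<close>; the extension splits only if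
  \<open>D g m = g (\<phi> m) - \<phi> (g m)\<close> for some function \<open>\<phi> : M \<rightarrow> N\<close>. Hence cocycles that are independent
  modulo such coboundaries bound the dimension of \<open>Ext\<^sup>1(M, N)\<close> from below
  (\<open>card_le_ext1_dim\<close>), and every arrow in the theorem comes from an explicit cocycle.

  The modules \<open>W\<close> are made concrete as function spaces. Taking the value of \<open>f\<close> at the affine map
  \<open>x \<mapsto> c\<^sup>-\<^sup>1 x\<close> as a function of the unit \<open>c\<close> identifies \<open>W\<close> with the functions \<open>\<phi>\<close> on \<open>U(R)\<close> that
  satisfy \<open>\<phi>(c h) = \<rho>(h) \<phi>(c)\<close> for \<open>h\<close> in the stabilizer of \<open>\<chi>\<close>, and \<open>x \<mapsto> a x + b\<close> then sends
  \<open>\<phi>\<close> to \<open>c \<mapsto> \<chi>(c b) \<phi>(a c)\<close>. Translations act diagonally, by distinct characters on distinct cosets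
  of the stabilizer. Averaging over them cuts a function down to one coset, which gives
  simplicity (\<open>W_simple\<close>).

  If \<open>\<chi>\<close> is trivial on \<open>\<mm>\<close>, then sending \<open>x \<mapsto> a x + b\<close> to the function \<open>c \<mapsto> \<chi>(c b) - 1\<close> is a
  cocycle from the trivial module to \<open>W\<close>. It describes the permutation module on the residue field,
  with the augmentation as its quotient. A coboundary would be the same for all maps
  \<open>x \<mapsto> b\<close>, so a nontrivial \<open>\<chi>\<close> gives a nonzero class (\<open>ext_trivial\<close>).

  For the arrows of \<open>p \<in> \<mm> - \<mm>\<^sup>2\<close>, the condition that links the orbits says
  \<open>\<chi>'(p x) = \<chi>(w x)\<close> for some unit \<open>w\<close>. Then \<open>\<phi> \<mapsto> \<phi>(w \<sqdot>)\<close> maps \<open>W\<close> to \<open>W'\<close> and behaves like an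
  action of \<open>x \<mapsto> p x\<close>. Composing it with units gives maps \<open>W \<rightarrow> W'\<close> for all \<open>x \<mapsto> e p x + b\<close>
  with \<open>e\<close> a unit; they do not depend on the choice of \<open>e\<close>, because \<open>e\<close> is determined up to a factor
  in \<open>1 + \<aa>\<close>, where \<open>\<aa>\<close> is the annihilator of \<open>p\<close>, and \<open>1 + \<aa>\<close> acts trivially on \<open>W\<close>. All
  other affine maps are sent to zero. The result is a cocycle because a product of two nonunits never has slope associated to \<open>p\<close>, its slope being in
  \<open>\<mm>\<^sup>2\<close> (\<open>D_mult\<close>). Nonunits act as zero on \<open>W\<close> and \<open>W'\<close>, so coboundaries are constant
  there, while the cocycles of nonassociated \<open>p\<^sub>i\<close> have disjoint supports. This makes the classes
  independent (\<open>arrows_independent\<close>).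
\<close>


section \<open>Modules over a monoid algebra\<close>

text \<open>
  Reduces identities that are linear in an element of a monoid algebra to multiples of monoid elements.
\<close>

lemma poly_mapping_add_induct [case_names zero single add]:
  assumes "P 0" and "\<And>k c. P (Poly_Mapping.single k c)" and "\<And>a b. P a \<Longrightarrow> P b \<Longrightarrow> P (a + b)"
  shows "P (f :: 'k \<Rightarrow>\<^sub>0 'c::comm_monoid_add)"
proof (induction f rule: Poly_Mapping.update_induct)
  case const
  show ?case by (rule assms(1))
next
  case (update f a b)
  have "Poly_Mapping.update a b f = f + Poly_Mapping.single a b"
    using update(1)
    by (intro poly_mapping_eqI)
       (auto simp: lookup_update lookup_add lookup_single in_keys_iff when_def)
  with update(3) assms(2,3) show ?case by metis
qed

lemma
  assumes "left_module M"
  shows module_zero: "0 \<in> car M"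
    and module_add: "x \<in> car M \<Longrightarrow> y \<in> car M \<Longrightarrow> x + y \<in> car M"
    and module_act: "x \<in> car M \<Longrightarrow> act M a x \<in> car M"
    and act_add_right: "x \<in> car M \<Longrightarrow> y \<in> car M \<Longrightarrow> act M a (x + y) = act M a x + act M a y"
    and act_add_left: "x \<in> car M \<Longrightarrow> act M (a + b) x = act M a x + act M b x"
    and act_mult: "x \<in> car M \<Longrightarrow> act M (a * b) x = act M a (act M b x)"
    and act_one: "x \<in> car M \<Longrightarrow> act M 1 x = x"
  using assms unfolding left_module_def by auto

lemma act_zero_right: "left_module M \<Longrightarrow> act M a 0 = 0"
  using act_add_right[of M 0 0 a] module_zero[of M] by simp

lemma act_zero_left: "left_module M \<Longrightarrow> x \<in> car M \<Longrightarrow> act M 0 x = 0"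
  using act_add_left[of M x 0 0] by simp

lemma module_sum:
  assumes "left_module M" "\<And>i. i \<in> I \<Longrightarrow> x i \<in> car M"
  shows "(\<Sum>i\<in>I. x i) \<in> car M"
  using assms(2)
  by (induction I rule: infinite_finite_induct) (auto simp: module_zero module_add assms(1))

lemma act_sum_right:
  assumes "left_module M" "\<And>i. i \<in> I \<Longrightarrow> x i \<in> car M"
  shows "act M a (\<Sum>i\<in>I. x i) = (\<Sum>i\<in>I. act M a (x i))"
  using assms(2)
  by (induction I rule: infinite_finite_induct)
     (auto simp: act_zero_right act_add_right module_sum assms(1))

lemma submodule_sum:
  assumes "submodule N M" "\<And>i. i \<in> I \<Longrightarrow> x i \<in> N"
  shows "(\<Sum>i\<in>I. x i) \<in> N"
  using assms(2)
  by (induction I rule: infinite_finite_induct) (use assms(1) in \<open>auto simp: submodule_def\<close>)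


lemma cover_map_add:
  assumes M: "left_module M"
    and keys: "Poly_Mapping.keys f \<subseteq> car M" "Poly_Mapping.keys f' \<subseteq> car M"
  shows "cover_map M (f + f') = cover_map M f + cover_map M f'"
proof -
  \<comment> \<open>Off the carrier the action is arbitrary, so the summand is cut off there before additivity is used.\<close>
  let ?F = "\<lambda>v a. if v \<in> car M then act M a v else 0"
  have eq: "cover_map M k = (\<Sum>v\<in>Poly_Mapping.keys k. ?F v (Poly_Mapping.lookup k v))"
    if "Poly_Mapping.keys k \<subseteq> car M" for k
    using that unfolding cover_map_def by (intro sum.cong) auto
  have "Poly_Mapping.keys (f + f') \<subseteq> car M"
    using keys_add[of f f'] keys by blast
  then show ?thesis
    unfolding eq[OF keys(1)] eq[OF keys(2)] by (subst eq, assumption)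
      (rule setsum_keys_plus_distrib; use keys in \<open>auto simp: act_zero_left M act_add_left\<close>)
qed

lemma cover_map_act:
  assumes M: "left_module M" and f: "Poly_Mapping.keys f \<subseteq> car M"
  shows "cover_map M (Poly_Mapping.map (\<lambda>b. a * b) f) = act M a (cover_map M f)"
proof -
  let ?l = "Poly_Mapping.lookup f"
  have lookup: "Poly_Mapping.lookup (Poly_Mapping.map (\<lambda>b. a * b) f) v = a * ?l v" for v
    by transfer (simp add: when_def)
  have "cover_map M (Poly_Mapping.map (\<lambda>b. a * b) f) = (\<Sum>v\<in>Poly_Mapping.keys f. act M (a * ?l v) v)"
    unfolding cover_map_def lookup
    by (intro sum.mono_neutral_left) (use f in \<open>auto simp: in_keys_iff lookup act_zero_left M\<close>)
  also have "\<dots> = (\<Sum>v\<in>Poly_Mapping.keys f. act M a (act M (?l v) v))"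
    using f by (intro sum.cong) (auto simp: act_mult[OF M])
  also have "\<dots> = act M a (cover_map M f)"
    unfolding cover_map_def
    using f by (subst act_sum_right[OF M]; force simp: module_act[OF M])
  finally show ?thesis .
qed

text \<open>
  The elements \<open>g[x] - [gx]\<close> are the part of the syzygy on which a cocycle can be read off directly.
\<close>

definition action_relation ::
  "('m::monoid_add \<Rightarrow>\<^sub>0 complex, 'v::ab_group_add) lmodule \<Rightarrow> 'm \<Rightarrow> 'v \<Rightarrow> 'v \<Rightarrow>\<^sub>0 'm \<Rightarrow>\<^sub>0 complex"
  where
  "action_relation M g x = Poly_Mapping.single x (Poly_Mapping.single g 1)
     - Poly_Mapping.single (act M (Poly_Mapping.single g 1) x) 1"

lemma action_relation_add:
  "action_relation M g x + Poly_Mapping.single (act M (Poly_Mapping.single g 1) x) 1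
     = Poly_Mapping.single x (Poly_Mapping.single g 1)"
  by (simp add: action_relation_def)

lemma single_one_nonzero: "Poly_Mapping.single g (1::complex) \<noteq> 0"
  by (metis keys_single keys_zero insert_not_empty zero_neq_one)

lemma action_relation_keys:
  assumes "left_module M" "x \<in> car M"
  shows "Poly_Mapping.keys (action_relation M g x) \<subseteq> car M"
  using module_act[OF assms] assms(2)
  by (auto simp: action_relation_def in_keys_iff lookup_minus lookup_single when_def split: if_splits)

lemma action_relation_in_syzygy:
  assumes M: "left_module M" and x: "x \<in> car M"
  shows "action_relation M g x \<in> car (syzygy M)"
proof -
  let ?y = "act M (Poly_Mapping.single g 1) x"
  have y: "?y \<in> car M"
    by (rule module_act[OF M x])
  have "cover_map M (action_relation M g x) + cover_map M (Poly_Mapping.single ?y 1)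
      = cover_map M (Poly_Mapping.single x (Poly_Mapping.single g 1))"
    using action_relation_keys[OF M x, of g] y
    by (simp add: cover_map_add[OF M, symmetric] action_relation_add)
  then have "cover_map M (action_relation M g x) = 0"
    using y by (simp add: cover_map_def act_one[OF M] single_one_nonzero)
  then show ?thesis
    using action_relation_keys[OF M x, of g] by (simp add: syzygy_def free_cover_def)
qed

text \<open>
  A homomorphism that extends to the free cover is determined by its values \<open>\<phi> x\<close> on the basis. On
  the elements \<open>g[x] - [gx]\<close> it therefore takes the values \<open>g(\<phi> x) - \<phi>(gx)\<close> of a coboundary, where
  \<open>\<phi>\<close> is an arbitrary function because the basis of the cover is the underlying set of the module.
\<close>

lemma restricted_hom_coboundary:
  fixes M :: "('m::monoid_add \<Rightarrow>\<^sub>0 complex, 'v::ab_group_add) lmodule"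
    and N :: "('m \<Rightarrow>\<^sub>0 complex, 'w::ab_group_add) lmodule"
  assumes M: "left_module M" and "h \<in> restricted_homs M N"
  obtains \<phi> where "\<And>x. x \<in> car M \<Longrightarrow> \<phi> x \<in> car N"
    and "\<And>g x. x \<in> car M \<Longrightarrow>
      h (action_relation M g x) + \<phi> (act M (Poly_Mapping.single g 1) x)
        = act N (Poly_Mapping.single g 1) (\<phi> x)"
proof -
  from assms(2) obtain G where G: "G \<in> module_homs (free_cover M) N"
    and h: "h = (\<lambda>f. if f \<in> car (syzygy M) then G f else 0)"
    by (auto simp: restricted_homs_def)
  have carF: "f \<in> car (free_cover M) \<longleftrightarrow> Poly_Mapping.keys f \<subseteq> car M" for f
    by (simp add: free_cover_def)
  show thesis
  proof
    fix x assume "x \<in> car M"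
    then show "G (Poly_Mapping.single x 1) \<in> car N"
      using G by (auto simp: module_homs_def carF)
  next
    fix g x
    assume x: "x \<in> car M"
    let ?y = "act M (Poly_Mapping.single g 1) x" and ?k = "action_relation M g x"
    have k: "?k \<in> car (syzygy M)"
      by (rule action_relation_in_syzygy[OF M x])
    have mem: "?k \<in> car (free_cover M)" "Poly_Mapping.single ?y 1 \<in> car (free_cover M)"
      "Poly_Mapping.single x 1 \<in> car (free_cover M)"
      using k x module_act[OF M x] by (auto simp: syzygy_def carF)
    have "Poly_Mapping.single x (Poly_Mapping.single g 1)
        = act (free_cover M) (Poly_Mapping.single g 1) (Poly_Mapping.single x 1)"
      by (simp add: free_cover_def)
    then have "G (Poly_Mapping.single x (Poly_Mapping.single g 1))
        = act N (Poly_Mapping.single g 1) (G (Poly_Mapping.single x 1))"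
      using G mem by (simp add: module_homs_def)
    moreover have "G (?k + Poly_Mapping.single ?y 1) = G ?k + G (Poly_Mapping.single ?y 1)"
      using G mem unfolding module_homs_def by blast
    ultimately show "h ?k + G (Poly_Mapping.single ?y 1)
        = act N (Poly_Mapping.single g 1) (G (Poly_Mapping.single x 1))"
      using k by (simp add: h action_relation_add)
  qed
qed


section \<open>Extensions from cocycles\<close>

text \<open>
  The last condition is the cocycle identity, with the product of the monoid written additively. It
  makes \<open>N \<oplus> M\<close> with the action \<open>(n, m) \<mapsto> (g n + D g m, g m)\<close> a module.
\<close>

locale module_cocycle =
  fixes M :: "('m::monoid_add \<Rightarrow>\<^sub>0 complex, 'v::ab_group_add) lmodule"
    and N :: "('m \<Rightarrow>\<^sub>0 complex, 'w::ab_group_add) lmodule"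
    and D :: "'m \<Rightarrow> 'v \<Rightarrow> 'w"
  assumes M: "left_module M" and N: "left_module N"
    and D_in: "x \<in> car M \<Longrightarrow> D g x \<in> car N"
    and D_add: "x \<in> car M \<Longrightarrow> y \<in> car M \<Longrightarrow> D g (x + y) = D g x + D g y"
    and D_scale: "x \<in> car M \<Longrightarrow>
      D g (act M (Poly_Mapping.single 0 c) x) = act N (Poly_Mapping.single 0 c) (D g x)"
    and D_mult: "x \<in> car M \<Longrightarrow>
      D (g + h) x = act N (Poly_Mapping.single g 1) (D h x) + D g (act M (Poly_Mapping.single h 1) x)"
begin

definition extend :: "('m \<Rightarrow>\<^sub>0 complex) \<Rightarrow> 'v \<Rightarrow> 'w" where
  "extend a x = (\<Sum>g\<in>Poly_Mapping.keys a.
     act N (Poly_Mapping.single 0 (Poly_Mapping.lookup a g)) (D g x))"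

lemma extend_in: "x \<in> car M \<Longrightarrow> extend a x \<in> car N"
  unfolding extend_def by (intro module_sum[OF N] module_act[OF N] D_in)

lemma extend_add_left: "x \<in> car M \<Longrightarrow> extend (a + b) x = extend a x + extend b x"
  unfolding extend_def
  by (rule setsum_keys_plus_distrib) (auto simp: act_zero_left N D_in single_add act_add_left)

lemma extend_zero_left: "extend 0 x = 0"
  by (simp add: extend_def)

lemma extend_single:
  "x \<in> car M \<Longrightarrow> extend (Poly_Mapping.single g c) x = act N (Poly_Mapping.single 0 c) (D g x)"
  by (cases "c = 0") (auto simp: extend_def act_zero_left N D_in)

lemma extend_add_right:
  "x \<in> car M \<Longrightarrow> y \<in> car M \<Longrightarrow> extend a (x + y) = extend a x + extend a y"
  unfolding extend_def by (simp add: D_add act_add_right N D_in sum.distrib)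

lemma extend_zero_right: "extend a 0 = 0"
  using extend_add_right[of 0 0 a] module_zero[OF M] by simp

lemma extend_sum_right:
  assumes "\<And>i. i \<in> I \<Longrightarrow> x i \<in> car M"
  shows "extend a (\<Sum>i\<in>I. x i) = (\<Sum>i\<in>I. extend a (x i))"
  using assms
  by (induction I rule: infinite_finite_induct)
     (auto simp: extend_zero_right extend_add_right module_sum M)

text \<open>
  Both sides are bilinear in \<open>a\<close> and \<open>b\<close>, so the cocycle identity for the monoid carries over to its
  algebra.
\<close>

lemma extend_mult:
  assumes x: "x \<in> car M"
  shows "extend (a * b) x = act N a (extend b x) + extend a (act M b x)"
proof (induction a rule: poly_mapping_add_induct)
  case zero
  show ?case using x by (simp add: extend_zero_left act_zero_left N extend_in)
next
  case (add a a')
  then show ?case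
    using x by (simp add: distrib_right extend_add_left act_add_left N extend_in module_act[OF M] add_ac)
next
  case (single g c)
  show ?case
  proof (induction b rule: poly_mapping_add_induct)
    case zero
    show ?case
      using x by (simp add: extend_zero_left extend_zero_right act_zero_left act_zero_right M N)
  next
    case (add b b')
    then show ?case
      using x by (simp add: distrib_left extend_add_left act_add_left act_add_right M N extend_in
          module_act[OF M] extend_add_right add_ac)
  next
    case (single h d)
    let ?s = "Poly_Mapping.single :: 'm \<Rightarrow> complex \<Rightarrow> _"
    have split: "?s k e = ?s 0 e * ?s k 1" "?s k e = ?s k 1 * ?s 0 e" for k e
      by (simp_all add: mult_single)
    have h1: "act M (?s h 1) x \<in> car M"
      using x by (simp add: module_act[OF M])
    have "D g (act M (?s h d) x) = D g (act M (?s 0 d) (act M (?s h 1) x))"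
      using x by (metis split(1) act_mult[OF M])
    also have "\<dots> = act N (?s 0 d) (D g (act M (?s h 1) x))"
      by (rule D_scale[OF h1])
    finally have right: "D g (act M (?s h d) x) = act N (?s 0 d) (D g (act M (?s h 1) x))" .
    have left: "act N (?s g c) (act N (?s 0 d) (D h x))
        = act N (?s 0 (c * d)) (act N (?s g 1) (D h x))"
      using x by (simp add: D_in act_mult[OF N, symmetric] mult_single)
    show ?case
      using x
      by (simp add: mult_single extend_single module_act[OF M] left right D_mult act_add_right N D_in
          module_act[OF N] act_mult[OF N, symmetric])
  qed
qed

definition cover_extend :: "('v \<Rightarrow>\<^sub>0 'm \<Rightarrow>\<^sub>0 complex) \<Rightarrow> 'w" where
  "cover_extend f = (\<Sum>v\<in>Poly_Mapping.keys f. extend (Poly_Mapping.lookup f v) v)"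

lemma cover_extend_add:
  assumes "Poly_Mapping.keys f \<subseteq> car M" "Poly_Mapping.keys f' \<subseteq> car M"
  shows "cover_extend (f + f') = cover_extend f + cover_extend f'"
  unfolding cover_extend_def
  by (rule setsum_keys_plus_distrib) (use assms in \<open>auto simp: extend_zero_left extend_add_left\<close>)

lemma cover_extend_act:
  assumes f: "Poly_Mapping.keys f \<subseteq> car M"
  shows "cover_extend (Poly_Mapping.map (\<lambda>b. a * b) f)
    = act N a (cover_extend f) + extend a (cover_map M f)"
proof -
  let ?l = "Poly_Mapping.lookup f"
  have lookup: "Poly_Mapping.lookup (Poly_Mapping.map (\<lambda>b. a * b) f) v = a * ?l v" for v
    by transfer (simp add: when_def)
  have "cover_extend (Poly_Mapping.map (\<lambda>b. a * b) f) = (\<Sum>v\<in>Poly_Mapping.keys f. extend (a * ?l v) v)"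
    unfolding cover_extend_def lookup
    by (intro sum.mono_neutral_left) (auto simp: in_keys_iff lookup extend_zero_left)
  also have "\<dots> = (\<Sum>v\<in>Poly_Mapping.keys f. act N a (extend (?l v) v) + extend a (act M (?l v) v))"
    using f by (intro sum.cong) (auto simp: extend_mult)
  also have "\<dots> = act N a (cover_extend f) + extend a (cover_map M f)"
    unfolding cover_extend_def cover_map_def sum.distrib
    using subsetD[OF f]
    by (simp add: act_sum_right[OF N] extend_sum_right extend_in module_act[OF M])
  finally show ?thesis .
qed

text \<open>
  The homomorphism from the syzygy to \<open>N\<close> that represents the class of the extension: on the free cover,
  \<open>cover_extend\<close> fails to be linear over the algebra by a term that depends only on the image in \<open>M\<close>,
  and this image vanishes on the syzygy.
\<close>

definition syzygy_hom :: "('v \<Rightarrow>\<^sub>0 'm \<Rightarrow>\<^sub>0 complex) \<Rightarrow> 'w" where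
  "syzygy_hom f = (if f \<in> car (syzygy M) then cover_extend f else 0)"

lemma syzygy_hom_is_hom: "syzygy_hom \<in> module_homs (syzygy M) N"
proof -
  have keys: "Poly_Mapping.keys f \<subseteq> car M" "cover_map M f = 0" if "f \<in> car (syzygy M)" for f
    using that by (auto simp: syzygy_def free_cover_def)
  have add: "f + f' \<in> car (syzygy M)" if "f \<in> car (syzygy M)" "f' \<in> car (syzygy M)" for f f'
    using keys[OF that(1)] keys[OF that(2)] keys_add[of f f'] cover_map_add[OF M, of f f']
    by (auto simp: syzygy_def free_cover_def)
  have act: "act (syzygy M) a f \<in> car (syzygy M)" if "f \<in> car (syzygy M)" for a f
  proof -
    have "Poly_Mapping.keys (Poly_Mapping.map (\<lambda>b. a * b) f) \<subseteq> Poly_Mapping.keys f"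
      by transfer auto
    with keys[OF that] cover_map_act[OF M, of f a] show ?thesis
      by (auto simp: syzygy_def free_cover_def act_zero_right M)
  qed
  have cover_act: "cover_extend (act (syzygy M) a f) = act N a (cover_extend f)"
    if "f \<in> car (syzygy M)" for a f
    using cover_extend_act[of f a] keys[OF that]
    by (simp add: syzygy_def free_cover_def extend_zero_right)
  have into: "cover_extend f \<in> car N" if "f \<in> car (syzygy M)" for f
    unfolding cover_extend_def using keys[OF that] by (intro module_sum[OF N] extend_in) auto
  show ?thesis
    unfolding module_homs_def syzygy_hom_def
    using into add act cover_act keys cover_extend_add by auto
qed

lemma D_zero: "x \<in> car M \<Longrightarrow> D 0 x = 0"
  using D_mult[of x 0 0] by (simp add: act_one M N D_in)

lemma syzygy_hom_relation:
  assumes x: "x \<in> car M"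
  shows "syzygy_hom (action_relation M g x) = D g x"
proof -
  let ?y = "act M (Poly_Mapping.single g 1) x"
  have y: "?y \<in> car M"
    by (rule module_act[OF M x])
  have one: "extend 1 y = 0" if "y \<in> car M" for y
    using extend_single[of y 0 1] that D_zero[of y] by (simp add: act_zero_right N)
  have "cover_extend (action_relation M g x) + cover_extend (Poly_Mapping.single ?y 1)
      = cover_extend (Poly_Mapping.single x (Poly_Mapping.single g 1))"
    using action_relation_keys[OF M x, of g] y
    by (simp add: cover_extend_add[symmetric] action_relation_add)
  then have "cover_extend (action_relation M g x) = D g x"
    using x y one act_one[OF N D_in]
    by (simp add: cover_extend_def extend_single single_one_nonzero)
  then show ?thesis
    by (simp add: syzygy_hom_def action_relation_in_syzygy M x)
qed

end

text \<open>
  The independence hypothesis is that of the cocycles modulo coboundaries. Applied to the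
  coefficients \<open>1\<close> and \<open>-1\<close> it also shows that different indices give different homomorphisms, so
  that none are lost when they are collected in a set.
\<close>

lemma card_le_ext1_dim:
  fixes M :: "('m::monoid_add \<Rightarrow>\<^sub>0 complex, 'v::ab_group_add) lmodule"
    and N :: "('m \<Rightarrow>\<^sub>0 complex, 'w::ab_group_add) lmodule"
  assumes "finite I"
    and cocycle: "\<And>i. i \<in> I \<Longrightarrow> module_cocycle M N (D i)"
    and M: "left_module M" and N: "left_module N"
    and independent: "\<And>c \<phi>. (\<And>x. x \<in> car M \<Longrightarrow> \<phi> x \<in> car N) \<Longrightarrow>
      (\<And>g x. x \<in> car M \<Longrightarrow>
         (\<Sum>i\<in>I. act N (Poly_Mapping.single 0 (c i)) (D i g x)) + \<phi> (act M (Poly_Mapping.single g 1) x)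
           = act N (Poly_Mapping.single g 1) (\<phi> x)) \<Longrightarrow> (\<forall>i\<in>I. c i = 0)"
  shows "enat (card I) \<le> ext1_dim M N"
proof -
  define H where "H i = module_cocycle.syzygy_hom M N (D i)" for i
  have H_hom: "H i \<in> module_homs (syzygy M) N" if "i \<in> I" for i
    unfolding H_def by (rule module_cocycle.syzygy_hom_is_hom[OF cocycle[OF that]])
  have H_R: "H i (action_relation M g x) = D i g x" if "i \<in> I" "x \<in> car M" for i g x
    unfolding H_def by (rule module_cocycle.syzygy_hom_relation[OF cocycle[OF that(1)] that(2)])
  have D_in: "D i g x \<in> car N" if "i \<in> I" "x \<in> car M" for i g x
    by (rule module_cocycle.D_in[OF cocycle[OF that(1)] that(2)])
  have inj: "inj_on H I"
  proof (rule inj_onI, rule ccontr)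
    fix i j assume ij: "i \<in> I" "j \<in> I" "H i = H j" "i \<noteq> j"
    define c :: "_ \<Rightarrow> complex" where "c k = (if k = i then 1 else if k = j then -1 else 0)" for k
    have "\<forall>k\<in>I. c k = 0"
    proof (rule independent[of "\<lambda>_. 0"])
      fix g x assume x: "x \<in> car M"
      have *: "D i g x = D j g x"
        using H_R[OF ij(1) x] H_R[OF ij(2) x] ij(3) by metis
      have "(\<Sum>k\<in>I. act N (Poly_Mapping.single 0 (c k)) (D k g x))
          = (\<Sum>k\<in>{i, j}. act N (Poly_Mapping.single 0 (c k)) (D k g x))"
        using \<open>finite I\<close> ij x
        by (intro sum.mono_neutral_right) (auto simp: c_def act_zero_left N D_in)
      also have "\<dots> = act N (Poly_Mapping.single 0 1) (D j g x)
          + act N (Poly_Mapping.single 0 (-1)) (D j g x)"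
        using ij(4) * by (simp add: c_def)
      also have "\<dots> = act N (Poly_Mapping.single 0 1 + Poly_Mapping.single 0 (-1)) (D j g x)"
        using D_in[OF ij(2) x] by (simp only: act_add_left[OF N])
      also have "\<dots> = 0"
        using D_in[OF ij(2) x] by (simp add: single_add[symmetric] act_zero_left N del: single_one)
      finally show "(\<Sum>k\<in>I. act N (Poly_Mapping.single 0 (c k)) (D k g x)) + 0
          = act N (Poly_Mapping.single g 1) 0"
        by (simp add: act_zero_right N)
    qed (simp add: module_zero N)
    with ij(1) show False by (auto simp: c_def)
  qed
  have "ext1_independent M N (H ` I)"
    unfolding ext1_independent_def
  proof (intro conjI allI impI)
    show "finite (H ` I)" "H ` I \<subseteq> module_homs (syzygy M) N"
      using \<open>finite I\<close> H_hom by auto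
  next
    fix c
    assume res: "(\<lambda>f. \<Sum>h\<in>H ` I. act N (Poly_Mapping.single 0 (c h)) (h f)) \<in> restricted_homs M N"
    from restricted_hom_coboundary[OF M res] obtain \<phi>
      where \<phi>: "\<And>x. x \<in> car M \<Longrightarrow> \<phi> x \<in> car N"
        and rel: "\<And>g x. x \<in> car M \<Longrightarrow>
          (\<Sum>h\<in>H ` I. act N (Poly_Mapping.single 0 (c h)) (h (action_relation M g x)))
             + \<phi> (act M (Poly_Mapping.single g 1) x) = act N (Poly_Mapping.single g 1) (\<phi> x)"
      by blast
    have "\<forall>i\<in>I. c (H i) = 0"
      by (rule independent[OF \<phi>]) (use rel in \<open>simp_all add: sum.reindex[OF inj] H_R\<close>)
    then show "\<forall>h\<in>H ` I. c h = 0" by blast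
  qed
  then have "enat (card (H ` I)) \<le> ext1_dim M N"
    unfolding ext1_dim_def by (intro SUP_upper) simp
  then show ?thesis
    by (simp add: card_image inj)
qed


section \<open>Units and characters\<close>

definition unit_inv :: "'r::comm_ring_1 \<Rightarrow> 'r" where
  "unit_inv u = (SOME v. u * v = 1)"

lemma unit_inv_right: "u dvd 1 \<Longrightarrow> u * unit_inv u = 1"
  unfolding unit_inv_def by (metis (mono_tags, lifting) dvdE someI_ex)

lemma unit_inv_left: "u dvd 1 \<Longrightarrow> unit_inv u * u = 1"
  using unit_inv_right[of u] by (simp add: mult.commute)

lemma unit_invI: "u * v = 1 \<Longrightarrow> unit_inv u = (v::'r::comm_ring_1)"
proof -
  assume uv: "u * v = 1"
  then have u: "u dvd 1" by (metis dvdI)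
  have "unit_inv u = unit_inv u * (u * v)" using uv by simp
  also have "\<dots> = v" using unit_inv_left[OF u] by (simp flip: mult.assoc)
  finally show ?thesis .
qed

lemma unit_inv_unit: "u dvd 1 \<Longrightarrow> unit_inv u dvd 1"
  by (metis dvdI unit_inv_left)

lemma unit_inv_inv: "u dvd 1 \<Longrightarrow> unit_inv (unit_inv u) = u"
  by (rule unit_invI) (rule unit_inv_left)

lemma unit_inv_mult: "u dvd 1 \<Longrightarrow> v dvd 1 \<Longrightarrow> unit_inv (u * v) = unit_inv u * unit_inv v"
proof (rule unit_invI)
  assume "u dvd 1" "v dvd 1"
  have "u * v * (unit_inv u * unit_inv v) = (u * unit_inv u) * (v * unit_inv v)"
    by (simp only: mult_ac)
  also have "\<dots> = 1"
    using \<open>u dvd 1\<close> \<open>v dvd 1\<close> by (simp add: unit_inv_right)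
  finally show "u * v * (unit_inv u * unit_inv v) = 1" .
qed

lemma unit_mult_iff: "a * b dvd 1 \<longleftrightarrow> a dvd 1 \<and> b dvd (1::'r::comm_ring_1)"
proof
  assume "a * b dvd 1"
  then show "a dvd 1 \<and> b dvd 1"
    by (auto intro: dvd_mult_left dvd_mult_right)
next
  assume ab: "a dvd 1 \<and> b dvd 1"
  then have "a * b * (unit_inv a * unit_inv b) = 1"
    using unit_inv_right[of a] unit_inv_right[of b]
    by (simp add: mult.left_commute[of b] mult.assoc)
  then show "a * b dvd 1" by (metis dvdI)
qed

lemma character_zero: "add_character \<chi> \<Longrightarrow> \<chi> 0 = 1"
  unfolding add_character_def by (metis add.right_neutral mult_cancel_left1)

lemma character_add: "add_character \<chi> \<Longrightarrow> \<chi> (a + b) = \<chi> a * \<chi> b"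
  by (simp add: add_character_def)

lemma character_minus: "add_character \<chi> \<Longrightarrow> \<chi> a * \<chi> (- a) = 1"
  by (metis character_add character_zero add.right_inverse)

text \<open>
  Orthogonality: shifting the summation variable by \<open>x\<close> multiplies the sum by \<open>\<chi> (c * x)\<close>.
\<close>

lemma character_sum:
  assumes "add_character (\<chi> :: 'r::{finite,comm_ring_1} \<Rightarrow> complex)"
  shows "(\<Sum>b\<in>UNIV. \<chi> (c * b)) = (if \<forall>b. \<chi> (c * b) = 1 then of_nat (card (UNIV::'r set)) else 0)"
proof (cases "\<forall>b. \<chi> (c * b) = 1")
  case False
  then obtain x where x: "\<chi> (c * x) \<noteq> 1" by blast
  have "(\<Sum>b\<in>UNIV. \<chi> (c * b)) = (\<Sum>b\<in>UNIV. \<chi> (c * (b + x)))"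
    by (rule sum.reindex_bij_witness[of _ "\<lambda>b. b + x" "\<lambda>b. b - x"]) auto
  also have "\<dots> = \<chi> (c * x) * (\<Sum>b\<in>UNIV. \<chi> (c * b))"
    by (simp add: distrib_left character_add[OF assms] sum_distrib_left mult.commute)
  finally have "(\<Sum>b\<in>UNIV. \<chi> (c * b)) = 0"
    using x by simp
  then show ?thesis using False by (simp only: if_False)
qed simp

lemma stab_unit: "h \<in> char_stab \<chi> \<Longrightarrow> h dvd 1"
  by (simp add: char_stab_def)

lemma stab_char: "h \<in> char_stab \<chi> \<Longrightarrow> \<chi> (h * a) = \<chi> a"
  by (simp add: char_stab_def)

text \<open>
  Multiplication by \<open>p\<close> commutes with \<open>U(R)\<close>, so a unit that fixes \<open>\<chi>'\<close> also fixes
  \<open>x \<mapsto> \<chi>' (p x)\<close>, which has the same stabilizer as \<open>\<chi>\<close>.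
\<close>

lemma char_stab_subset:
  assumes w: "w dvd 1" and chars: "\<And>x. \<chi>' (p * x) = \<chi> (w * x)"
  shows "char_stab \<chi>' \<subseteq> char_stab \<chi>"
proof
  fix h assume h: "h \<in> char_stab \<chi>'"
  have "\<chi> (h * a) = \<chi> a" for a
  proof -
    have a: "a = w * (unit_inv w * a)"
      using unit_inv_right[OF w] by (simp flip: mult.assoc)
    have "\<chi> (h * a) = \<chi> (w * (h * (unit_inv w * a)))"
      by (subst a) (simp only: mult_ac)
    also have "\<dots> = \<chi>' (p * (h * (unit_inv w * a)))"
      by (rule chars[symmetric])
    also have "\<dots> = \<chi>' (h * (p * (unit_inv w * a)))"
      by (simp only: mult.left_commute)
    also have "\<dots> = \<chi> (w * (unit_inv w * a))"
      by (simp only: stab_char[OF h] chars)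
    finally show ?thesis by (simp only: a[symmetric])
  qed
  then show "h \<in> char_stab \<chi>"
    using stab_unit[OF h] by (simp add: char_stab_def)
qed

lemma char_stab_translate:
  assumes "v dvd 1"
  shows "char_stab (\<lambda>a. \<chi> (v * a)) = char_stab \<chi>"
proof -
  have "(\<forall>a. \<chi> (v * (h * a)) = \<chi> (v * a)) \<longleftrightarrow> (\<forall>a. \<chi> (h * a) = \<chi> a)" for h
  proof
    assume L: "\<forall>a. \<chi> (v * (h * a)) = \<chi> (v * a)"
    show "\<forall>a. \<chi> (h * a) = \<chi> a"
    proof
      fix a
      have v: "v * (unit_inv v * b) = b" for b
        using unit_inv_right[OF assms] by (simp flip: mult.assoc)
      have "v * (h * (unit_inv v * a)) = h * (v * (unit_inv v * a))"
        by (simp only: mult.left_commute)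
      then show "\<chi> (h * a) = \<chi> a"
        using L[rule_format, of "unit_inv v * a"] by (simp only: v)
    qed
  next
    assume R: "\<forall>a. \<chi> (h * a) = \<chi> a"
    then show "\<forall>a. \<chi> (v * (h * a)) = \<chi> (v * a)"
      by (metis mult.left_commute)
  qed
  then show ?thesis by (simp add: char_stab_def)
qed

lemma stab_one: "1 \<in> char_stab \<chi>"
  by (simp add: char_stab_def)

lemma stab_inv: "h \<in> char_stab \<chi> \<Longrightarrow> unit_inv h \<in> char_stab \<chi>"
proof -
  assume h: "h \<in> char_stab \<chi>"
  have "\<chi> (unit_inv h * a) = \<chi> a" for a
    using stab_char[OF h, of "unit_inv h * a"] unit_inv_right[OF stab_unit[OF h]]
    by (simp flip: mult.assoc)
  then show ?thesis
    using stab_unit[OF h] by (simp add: char_stab_def unit_inv_unit)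
qed


section \<open>The induced modules as spaces of functions on the unit group\<close>

lemma Aff_add: "Aff a b + Aff c d = Aff (a * c) (a * d + b)"
  by (simp add: plus_aff_def)

lemma aff_units_iff: "Aff a b \<in> aff_units \<longleftrightarrow> a dvd 1"
  by (simp add: aff_units_def)

lemma aff_units_slope: "g \<in> aff_units \<longleftrightarrow> slope g dvd 1"
  by (cases g) (simp add: aff_units_iff)

lemma slope_add: "slope (g + h) = slope g * slope h"
  and shift_add: "shift (g + h) = slope g * shift h + shift g"
  by (simp_all add: plus_aff_def)

lemma zero_in_aff_units: "0 \<in> aff_units"
  by (simp add: aff_units_slope zero_aff_def)

lemma aff_units_add_iff: "g + h \<in> aff_units \<longleftrightarrow> g \<in> aff_units \<and> h \<in> aff_units"
  by (simp add: aff_units_slope slope_add unit_mult_iff)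

lemma finite_aff: "finite (A :: 'r::{finite,comm_ring_1} aff set)"
proof (rule finite_subset)
  show "A \<subseteq> range (\<lambda>(a, b). Aff a b)"
  proof
    fix g :: "'r aff"
    have "g = (\<lambda>(a, b). Aff a b) (slope g, shift g)" by simp
    then show "g \<in> range (\<lambda>(a, b). Aff a b)" by blast
  qed
  show "finite (range (\<lambda>(a, b). Aff a b) :: 'r aff set)"
    by (rule finite_imageI) simp
qed

text \<open>
  The inverse for composition, which is the operation written \<open>+\<close>.
\<close>

definition aff_inv :: "'r::comm_ring_1 aff \<Rightarrow> 'r aff" where
  "aff_inv g = Aff (unit_inv (slope g)) (- unit_inv (slope g) * shift g)"

lemma aff_inv_left: "g \<in> aff_units \<Longrightarrow> aff_inv g + g = 0"
  by (cases g) (simp add: aff_inv_def aff_units_iff Aff_add zero_aff_def unit_inv_left)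

lemma aff_inv_right: "g \<in> aff_units \<Longrightarrow> g + aff_inv g = 0"
  by (cases g) (simp add: aff_inv_def aff_units_iff Aff_add zero_aff_def unit_inv_right
      flip: mult.assoc)

lemma aff_inv_unit: "g \<in> aff_units \<Longrightarrow> aff_inv g \<in> aff_units"
  by (simp add: aff_inv_def aff_units_slope unit_inv_unit)

lemma lookup_single_times:
  fixes f :: "'r::comm_ring_1 aff \<Rightarrow>\<^sub>0 complex"
  assumes g: "g \<in> aff_units"
  shows "Poly_Mapping.lookup (Poly_Mapping.single g \<alpha> * f) k
    = \<alpha> * Poly_Mapping.lookup f (aff_inv g + k)"
proof -
  have k: "k = g + q \<longleftrightarrow> q = aff_inv g + k" for q
  proof
    assume "k = g + q"
    then show "q = aff_inv g + k" using aff_inv_left[OF g] by (simp flip: add.assoc)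
  next
    assume "q = aff_inv g + k"
    then show "k = g + q" using aff_inv_right[OF g] by (simp flip: add.assoc)
  qed
  have "Poly_Mapping.lookup (Poly_Mapping.single g \<alpha> * f) k
      = (\<Sum>l. \<alpha> * (\<Sum>q. Poly_Mapping.lookup f q when k = l + q) when l = g)"
    unfolding lookup_mult by (intro Sum_any.cong) (auto simp: lookup_single when_def)
  also have "\<dots> = \<alpha> * (\<Sum>q. Poly_Mapping.lookup f q when q = aff_inv g + k)"
    by (simp add: k)
  finally show ?thesis by simp
qed

locale affine_rep =
  fixes \<chi> \<rho> :: "'r::{finite,comm_ring_1} \<Rightarrow> complex"
  assumes char: "add_character \<chi>" and mult_char: "mult_character_on (char_stab \<chi>) \<rho>"
begin

abbreviation "W \<equiv> W_module \<chi> \<rho>"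

text \<open>
  The functions on the unit group that correspond to elements of \<open>W\<close>. Values at nonunits are left
  open.
\<close>

definition equivariant :: "('r \<Rightarrow> complex) \<Rightarrow> bool" where
  "equivariant \<phi> \<longleftrightarrow> (\<forall>c h. c dvd 1 \<longrightarrow> h \<in> char_stab \<chi> \<longrightarrow> \<phi> (c * h) = \<rho> h * \<phi> c)"

text \<open>
  The inverse of \<open>c\<close> turns the left action on functions into \<open>\<phi> \<mapsto> \<phi>(a \<sqdot>)\<close>, see \<open>fun_of_act\<close>, which
  keeps inverses out of all later computations.
\<close>

definition fun_of :: "('r aff \<Rightarrow>\<^sub>0 complex) \<Rightarrow> 'r \<Rightarrow> complex" where
  "fun_of f c = Poly_Mapping.lookup f (Aff (unit_inv c) 0)"

text \<open>
  The value at \<open>x \<mapsto> u x + d\<close> is forced: this map is \<open>x \<mapsto> u x\<close> composed with the translation by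
  \<open>u\<^sup>-\<^sup>1 d\<close>, which lies in the inducing subgroup.
\<close>

definition of_fun :: "('r \<Rightarrow> complex) \<Rightarrow> 'r aff \<Rightarrow>\<^sub>0 complex" where
  "of_fun \<phi> = Abs_poly_mapping (\<lambda>g. if slope g dvd 1
     then \<chi> (- unit_inv (slope g) * shift g) * \<phi> (unit_inv (slope g)) else 0)"

lemma char_nonzero: "\<chi> a \<noteq> 0"
  using char by (simp add: add_character_def)

lemma rho_nonzero: "h \<in> char_stab \<chi> \<Longrightarrow> \<rho> h \<noteq> 0"
  using mult_char by (simp add: mult_character_on_def)

lemma rho_mult: "g \<in> char_stab \<chi> \<Longrightarrow> h \<in> char_stab \<chi> \<Longrightarrow> \<rho> (g * h) = \<rho> g * \<rho> h"
  using mult_char by (simp add: mult_character_on_def)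

lemma rho_one: "\<rho> 1 = 1"
  using rho_mult[of 1 1] rho_nonzero[of 1] by (simp add: stab_one)

lemma rho_inv: "h \<in> char_stab \<chi> \<Longrightarrow> \<rho> h * \<rho> (unit_inv h) = 1"
  using rho_mult[of h "unit_inv h"] by (simp add: stab_inv unit_inv_right stab_unit rho_one)

lemma W_car: "f \<in> car W \<longleftrightarrow> Poly_Mapping.keys f \<subseteq> aff_units \<and>
   (\<forall>u d a b. u dvd 1 \<longrightarrow> a \<in> char_stab \<chi> \<longrightarrow>
      \<chi> b * \<rho> a * Poly_Mapping.lookup f (Aff (u * a) (u * b + d)) = Poly_Mapping.lookup f (Aff u d))"
  (is "_ \<longleftrightarrow> _ \<and> ?E")
proof -
  have ball: "(\<forall>g\<in>{Aff a b | a b. P a}. Q g) \<longleftrightarrow> (\<forall>a b. P a \<longrightarrow> Q (Aff a b))" for P and Q :: "'r aff \<Rightarrow> bool"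
    by auto
  have "?E \<longleftrightarrow> (\<forall>g\<in>aff_units. \<forall>h\<in>{Aff a b | a b. a \<in> char_stab \<chi>}.
      \<chi> (shift h) * \<rho> (slope h) * Poly_Mapping.lookup f (g + h) = Poly_Mapping.lookup f g)"
    unfolding aff_units_def ball by (auto simp: Aff_add)
  then show ?thesis
    by (simp add: W_module_def induced_module_def)
qed

lemma W_keys: "f \<in> car W \<Longrightarrow> Poly_Mapping.keys f \<subseteq> aff_units"
  by (simp add: W_car)

lemma W_equivariant:
  assumes "f \<in> car W" "u dvd 1" "a \<in> char_stab \<chi>"
  shows "\<chi> b * \<rho> a * Poly_Mapping.lookup f (Aff (u * a) (u * b + d)) = Poly_Mapping.lookup f (Aff u d)"
  using assms unfolding W_car by blast

lemma lookup_W: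
  assumes "f \<in> car W" "u dvd 1"
  shows "Poly_Mapping.lookup f (Aff u d) = \<chi> (- unit_inv u * d) * fun_of f (unit_inv u)"
proof -
  have "\<chi> (unit_inv u * d) * \<rho> 1 * Poly_Mapping.lookup f (Aff (u * 1) (u * (unit_inv u * d) + 0))
      = Poly_Mapping.lookup f (Aff u 0)"
    by (intro W_equivariant assms stab_one)
  then have "\<chi> (unit_inv u * d) * Poly_Mapping.lookup f (Aff u d) = fun_of f (unit_inv u)"
    using assms(2) by (simp add: rho_one fun_of_def unit_inv_inv unit_inv_right flip: mult.assoc)
  then have "\<chi> (- unit_inv u * d) * fun_of f (unit_inv u)
      = (\<chi> (unit_inv u * d) * \<chi> (- (unit_inv u * d))) * Poly_Mapping.lookup f (Aff u d)"
    by (simp add: mult_ac flip: minus_mult_left)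
  then show ?thesis
    by (simp add: character_minus[OF char])
qed

lemma W_eqI:
  assumes "f \<in> car W" "f' \<in> car W" "\<And>c. c dvd 1 \<Longrightarrow> fun_of f c = fun_of f' c"
  shows "f = f'"
proof (rule poly_mapping_eqI)
  fix k :: "'r aff"
  obtain u d where k: "k = Aff u d" by (cases k)
  show "Poly_Mapping.lookup f k = Poly_Mapping.lookup f' k"
  proof (cases "u dvd 1")
    case True
    then show ?thesis using assms by (simp add: k lookup_W unit_inv_unit)
  next
    case False
    then have "k \<notin> Poly_Mapping.keys f" "k \<notin> Poly_Mapping.keys f'"
      using assms(1,2) by (auto simp: W_car k aff_units_iff dest!: subsetD)
    then show ?thesis by (simp add: in_keys_iff)
  qed
qed

lemma fun_of_equivariant:
  assumes "f \<in> car W"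
  shows "equivariant (fun_of f)"
  unfolding equivariant_def
proof (intro allI impI)
  fix c h :: 'r assume c: "c dvd 1" and h: "h \<in> char_stab \<chi>"
  have "\<chi> 0 * \<rho> h * Poly_Mapping.lookup f (Aff (unit_inv (c * h) * h) (unit_inv (c * h) * 0 + 0))
      = Poly_Mapping.lookup f (Aff (unit_inv (c * h)) 0)"
    using c stab_unit[OF h] by (intro W_equivariant assms h) (simp add: unit_inv_unit unit_mult_iff)
  moreover have "unit_inv (c * h) * h = unit_inv c"
    using c stab_unit[OF h] by (simp add: unit_inv_mult mult.assoc unit_inv_left)
  ultimately show "fun_of f (c * h) = \<rho> h * fun_of f c"
    by (simp add: fun_of_def character_zero[OF char])
qed

lemma fun_of_stab: "f \<in> car W \<Longrightarrow> c dvd 1 \<Longrightarrow> h \<in> char_stab \<chi> \<Longrightarrow> fun_of f (c * h) = \<rho> h * fun_of f c"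
  using fun_of_equivariant by (simp add: equivariant_def)

lemma lookup_enc: "Poly_Mapping.lookup (of_fun \<phi>) (Aff u d)
    = (if u dvd 1 then \<chi> (- unit_inv u * d) * \<phi> (unit_inv u) else 0)"
  unfolding of_fun_def by (subst lookup_Abs_poly_mapping) (simp_all add: finite_aff)

lemma fun_of_of_fun: "c dvd 1 \<Longrightarrow> fun_of (of_fun \<phi>) c = \<phi> c"
  by (simp add: fun_of_def lookup_enc unit_inv_unit unit_inv_inv character_zero[OF char])

lemma of_fun_in:
  assumes "equivariant \<phi>"
  shows "of_fun \<phi> \<in> car W"
  unfolding W_car
proof (intro conjI allI impI)
  show "Poly_Mapping.keys (of_fun \<phi>) \<subseteq> aff_units"
  proof
    fix g assume "g \<in> Poly_Mapping.keys (of_fun \<phi>)"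
    then show "g \<in> aff_units"
      by (cases g) (auto simp: in_keys_iff lookup_enc aff_units_iff split: if_splits)
  qed
next
  fix u d a b :: 'r assume u: "u dvd 1" and a: "a \<in> char_stab \<chi>"
  note ua = stab_unit[OF a]
  let ?u = "unit_inv u" and ?a = "unit_inv a"
  have "\<phi> (?u * ?a * a) = \<rho> a * \<phi> (?u * ?a)"
    using assms u ua a unfolding equivariant_def by (simp add: unit_mult_iff unit_inv_unit)
  then have \<phi>: "\<phi> ?u = \<rho> a * \<phi> (?u * ?a)"
    using ua by (simp add: mult.assoc unit_inv_left)
  have "- (?u * ?a * (u * b + d)) = ?a * (- b + - ?u * d)"
  proof -
    have "- (?u * ?a * (u * b + d)) = - (?u * u) * (?a * b) + - (?u * ?a * d)"
      by (simp add: algebra_simps)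
    also have "\<dots> = ?a * (- b + - ?u * d)"
      by (simp only: unit_inv_left[OF u]) (simp add: algebra_simps)
    finally show ?thesis .
  qed
  then have "\<chi> (- (?u * ?a * (u * b + d))) = \<chi> (- b) * \<chi> (- ?u * d)"
    using stab_char[OF stab_inv[OF a]] character_add[OF char] by metis
  then have "\<chi> b * \<chi> (- (?u * ?a * (u * b + d))) = \<chi> (- ?u * d)"
    using character_minus[OF char, of b] by simp
  then show "\<chi> b * \<rho> a * Poly_Mapping.lookup (of_fun \<phi>) (Aff (u * a) (u * b + d))
      = Poly_Mapping.lookup (of_fun \<phi>) (Aff u d)"
    using u ua by (simp add: lookup_enc unit_mult_iff unit_inv_mult \<phi> mult_ac)
qed

lemma act_W_single: "act W (Poly_Mapping.single g \<alpha>) f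
    = (if g \<in> aff_units then Poly_Mapping.single g \<alpha> * f else 0)"
  by (cases "\<alpha> = 0") (auto simp: W_module_def induced_module_def)

lemma act_W_add: "act W (a + b) f = act W a f + act W b f"
proof -
  have eq: "act W a f = (\<Sum>g\<in>Poly_Mapping.keys a. (if g \<in> aff_units
      then Poly_Mapping.single g (Poly_Mapping.lookup a g) * f else 0))" for a
    unfolding W_module_def induced_module_def
    by (simp only: lmodule.select_convs sum.inter_restrict finite_keys)
  show ?thesis
    unfolding eq by (rule setsum_keys_plus_distrib) (auto simp: single_add distrib_right)
qed

lemma act_W_zero: "act W 0 f = 0"
  by (simp add: W_module_def induced_module_def)

lemma W_zero: "0 \<in> car W"
  by (simp add: W_car)

lemma W_add:
  assumes "f \<in> car W" "f' \<in> car W"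
  shows "f + f' \<in> car W"
proof -
  have "Poly_Mapping.keys (f + f') \<subseteq> aff_units"
    using W_keys[OF assms(1)] W_keys[OF assms(2)] keys_add[of f f'] by blast
  moreover have "\<chi> b * \<rho> a * Poly_Mapping.lookup (f + f') (Aff (u * a) (u * b + d))
      = Poly_Mapping.lookup (f + f') (Aff u d)" if "u dvd 1" "a \<in> char_stab \<chi>" for u d a b
    using W_equivariant[OF assms(1) that] W_equivariant[OF assms(2) that]
    by (simp only: lookup_add distrib_left)
  ultimately show ?thesis
    unfolding W_car by blast
qed

lemma act_W_single_in:
  assumes f: "f \<in> car W"
  shows "act W (Poly_Mapping.single g \<alpha>) f \<in> car W"
proof (cases "g \<in> aff_units")
  case True
  obtain x y where g: "aff_inv g = Aff x y" by (cases "aff_inv g")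
  then have x: "x dvd 1" using aff_inv_unit[OF True] by (simp add: aff_units_iff)
  have keys: "Poly_Mapping.keys (Poly_Mapping.single g \<alpha> * f) \<subseteq> aff_units"
  proof -
    have "Poly_Mapping.keys (Poly_Mapping.single g \<alpha>) \<subseteq> {g}" by simp
    then show ?thesis
      using keys_mult[of "Poly_Mapping.single g \<alpha>" f] True W_keys[OF f] aff_units_add_iff by blast
  qed
  have *: "\<chi> b * \<rho> a * Poly_Mapping.lookup f (Aff x y + Aff (u * a) (u * b + d))
      = Poly_Mapping.lookup f (Aff x y + Aff u d)" if "u dvd 1" "a \<in> char_stab \<chi>" for u d a b
  proof -
    have "\<chi> b * \<rho> a * Poly_Mapping.lookup f (Aff (x * u * a) (x * u * b + (x * d + y)))
        = Poly_Mapping.lookup f (Aff (x * u) (x * d + y))"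
      by (rule W_equivariant[OF f]) (use that x in \<open>simp_all add: unit_mult_iff\<close>)
    moreover have "Aff x y + Aff (u * a) (u * b + d) = Aff (x * u * a) (x * u * b + (x * d + y))"
      by (simp add: Aff_add algebra_simps)
    moreover have "Aff x y + Aff u d = Aff (x * u) (x * d + y)"
      by (simp add: Aff_add)
    ultimately show ?thesis by (simp only:)
  qed
  have "\<chi> b * \<rho> a * (\<alpha> * Poly_Mapping.lookup f (Aff x y + Aff (u * a) (u * b + d)))
      = \<alpha> * Poly_Mapping.lookup f (Aff x y + Aff u d)" if "u dvd 1" "a \<in> char_stab \<chi>" for u d a b
    by (simp only: mult.left_commute[of "\<chi> b * \<rho> a" \<alpha>] *[OF that])
  with keys show ?thesis
    unfolding W_car by (simp only: act_W_single True if_True lookup_single_times g) blast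
qed (simp add: act_W_single W_zero)

lemma W_left_module: "left_module W"
proof -
  have in_car: "act W a f \<in> car W" if "f \<in> car W" for a f
    by (induction a rule: poly_mapping_add_induct)
       (use that in \<open>auto simp: act_W_zero W_zero act_W_single_in act_W_add W_add\<close>)
  have right: "act W a (f + f') = act W a f + act W a f'" for a f f'
    by (simp add: W_module_def induced_module_def distrib_left sum.distrib)
  have right0: "act W a 0 = 0" for a
    by (simp add: W_module_def induced_module_def)
  have mult: "act W (a * b) f = act W a (act W b f)" for a b f
  proof (induction a rule: poly_mapping_add_induct)
    case (single g \<alpha>)
    show ?case
    proof (induction b rule: poly_mapping_add_induct)
      case (single h \<beta>)
      show ?case
        by (simp add: mult_single act_W_single aff_units_add_iff flip: mult.assoc)
    qed (simp_all add: act_W_zero right0 distrib_left act_W_add right)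
  qed (simp_all add: act_W_zero distrib_right act_W_add)
  have one: "act W 1 f = f" if "f \<in> car W" for f
    using act_W_single[of 0 1 f] by (simp add: zero_in_aff_units)
  show ?thesis
    unfolding left_module_def using W_zero W_add in_car right act_W_add mult one by blast
qed

lemma fun_of_zero: "fun_of 0 c = 0"
  by (simp add: fun_of_def)

lemma fun_of_add: "fun_of (f + f') c = fun_of f c + fun_of f' c"
  by (simp add: fun_of_def lookup_add)

lemma fun_of_sum: "fun_of (\<Sum>i\<in>I. f i) c = (\<Sum>i\<in>I. fun_of (f i) c)"
  by (simp add: fun_of_def lookup_sum)

lemma fun_of_act:
  assumes f: "f \<in> car W" and g: "g \<in> aff_units" and c: "c dvd 1"
  shows "fun_of (act W (Poly_Mapping.single g \<alpha>) f) c = \<alpha> * \<chi> (c * shift g) * fun_of f (slope g * c)"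
proof -
  obtain a b where ab: "g = Aff a b" by (cases g)
  have a: "a dvd 1" using g by (simp add: ab aff_units_iff)
  have "a * (c * (unit_inv a * b)) = (a * unit_inv a) * (c * b)"
    by (simp only: mult_ac)
  then have "a * (c * (unit_inv a * b)) = c * b"
    using a by (simp add: unit_inv_right)
  then have "\<chi> (- unit_inv (unit_inv (a * c)) * (- unit_inv a * b)) = \<chi> (c * b)"
    using a c by (simp add: unit_inv_inv unit_mult_iff mult.assoc)
  moreover have "aff_inv g + Aff (unit_inv c) 0 = Aff (unit_inv (a * c)) (- unit_inv a * b)"
    using a c by (simp add: aff_inv_def ab Aff_add unit_inv_mult)
  moreover have "Poly_Mapping.lookup f (Aff (unit_inv (a * c)) (- unit_inv a * b))
      = \<chi> (- unit_inv (unit_inv (a * c)) * (- unit_inv a * b)) * fun_of f (unit_inv (unit_inv (a * c)))"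
    using a c by (intro lookup_W f) (simp add: unit_inv_unit unit_mult_iff)
  moreover have "fun_of (act W (Poly_Mapping.single g \<alpha>) f) c
      = \<alpha> * Poly_Mapping.lookup f (aff_inv g + Aff (unit_inv c) 0)"
    using g by (simp only: fun_of_def act_W_single if_True lookup_single_times)
  ultimately show ?thesis
    using a c by (simp add: ab unit_inv_inv unit_mult_iff)
qed

lemma fun_of_scale:
  assumes "f \<in> car W" "c dvd 1"
  shows "fun_of (act W (Poly_Mapping.single 0 \<alpha>) f) c = \<alpha> * fun_of f c"
  using fun_of_act[OF assms(1) zero_in_aff_units assms(2), of \<alpha>]
  by (simp add: zero_aff_def character_zero[OF char])

lemma act_W_nonunit: "g \<notin> aff_units \<Longrightarrow> act W (Poly_Mapping.single g \<alpha>) f = 0"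
  by (simp add: act_W_single)


text \<open>
  A nonzero submodule contains some \<open>f\<close> that does not vanish at a unit \<open>c0\<close>. Move the value at \<open>c0\<close> to
  any unit \<open>e\<close> by a slope and average over translations against the character \<open>b \<mapsto> \<chi> (e b)\<close>: the
  result is supported on the coset of \<open>e\<close>. Combining these elements over all \<open>e\<close> yields every
  element \<open>F\<close> of \<open>W\<close>.
\<close>

lemma W_simple: "simple_module W"
  unfolding simple_module_def
proof (intro conjI allI impI)
  show "left_module W" by (rule W_left_module)
next
  have "equivariant (\<lambda>c. if c \<in> char_stab \<chi> then \<rho> c else 0)"
    unfolding equivariant_def
  proof (intro allI impI)
    fix c h :: 'r assume c: "c dvd 1" and h: "h \<in> char_stab \<chi>"
    have "\<chi> (c * h * a) = \<chi> (c * a)" for a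
      using stab_char[OF h, of "c * a"] by (simp add: mult_ac)
    then have "c * h \<in> char_stab \<chi> \<longleftrightarrow> c \<in> char_stab \<chi>"
      using c stab_unit[OF h] by (auto simp: char_stab_def unit_mult_iff)
    then show "(if c * h \<in> char_stab \<chi> then \<rho> (c * h) else 0)
        = \<rho> h * (if c \<in> char_stab \<chi> then \<rho> c else 0)"
      using h by (simp add: rho_mult mult.commute)
  qed
  note in_W = of_fun_in[OF this]
  moreover have "of_fun (\<lambda>c. if c \<in> char_stab \<chi> then \<rho> c else 0) \<noteq> 0"
    using fun_of_of_fun[of 1 "\<lambda>c. if c \<in> char_stab \<chi> then \<rho> c else 0"]
    by (auto simp: stab_one rho_one fun_of_zero)
  ultimately show "car W \<noteq> {0}" by blast
next
  fix N assume N: "submodule N W"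
  then have N_sub: "N \<subseteq> car W" and N_0: "0 \<in> N" and N_act: "\<And>a f. f \<in> N \<Longrightarrow> act W a f \<in> N"
    by (auto simp: submodule_def)
  show "N = {0} \<or> N = car W"
  proof (cases "N = {0}")
    case False
    then obtain f where f: "f \<in> N" "f \<noteq> 0" using N_0 by blast
    then have f_W: "f \<in> car W" using N_sub by blast
    have "\<exists>c0. c0 dvd 1 \<and> fun_of f c0 \<noteq> 0"
    proof (rule ccontr)
      assume "\<not> ?thesis"
      then have "f = 0" by (intro W_eqI f_W W_zero) (auto simp: fun_of_zero)
      with f(2) show False by simp
    qed
    then obtain c0 where c0: "c0 dvd 1" "fun_of f c0 \<noteq> 0" by blast
    define n s :: complex where "n = of_nat (card (UNIV :: 'r set))" and "s = of_nat (card (char_stab \<chi>))"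
    have n0: "n \<noteq> 0" by (simp add: n_def)
    have s0: "s \<noteq> 0" using stab_one[of \<chi>] by (auto simp: s_def)
    \<comment> \<open>\<open>n\<close> comes from the sum over translations; \<open>s\<close> is there because every coset is hit once for each of its elements.\<close>
    define K where "K = n * s * fun_of f c0"
    have K0: "K \<noteq> 0" using n0 s0 c0(2) by (simp add: K_def)
    have "F \<in> N" if F: "F \<in> car W" for F
    proof -
      define t where "t e b = act W (Poly_Mapping.single (Aff (c0 * unit_inv e) b)
        (fun_of F e / K * \<chi> (- e * b))) f" for e b
      define G where "G = (\<Sum>e | e dvd 1. \<Sum>b\<in>UNIV. t e b)"
      have G_N: "G \<in> N"
        unfolding G_def t_def by (intro submodule_sum[OF N] N_act f)
      have "fun_of G c = fun_of F c" if c: "c dvd 1" for c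
      proof -
        have coset: "(\<forall>b. \<chi> ((c - e) * b) = 1) \<longleftrightarrow> e \<in> (*) c ` char_stab \<chi>" if e: "e dvd 1" for e
        proof -
          have "\<chi> ((c - e) * b) = 1 \<longleftrightarrow> \<chi> (c * b) = \<chi> (e * b)" for b
          proof -
            have "\<chi> (c * b) = \<chi> ((c - e) * b) * \<chi> (e * b)"
              by (simp add: algebra_simps flip: character_add[OF char])
            then show ?thesis using char_nonzero[of "e * b"] by simp
          qed
          moreover have "(\<forall>b. \<chi> (c * b) = \<chi> (e * b)) \<longleftrightarrow> e \<in> (*) c ` char_stab \<chi>"
          proof
            assume eq: "\<forall>b. \<chi> (c * b) = \<chi> (e * b)"
            have "\<chi> (unit_inv c * e * a) = \<chi> a" for a
            proof -
              have "c * (unit_inv c * a) = a"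
                using unit_inv_right[OF c] by (simp flip: mult.assoc)
              moreover have "e * (unit_inv c * a) = unit_inv c * e * a"
                by (simp only: mult_ac)
              ultimately show ?thesis using eq[rule_format, of "unit_inv c * a"] by (simp only:)
            qed
            then have "unit_inv c * e \<in> char_stab \<chi>"
              using c e by (simp add: char_stab_def unit_mult_iff unit_inv_unit)
            moreover have "e = c * (unit_inv c * e)"
              using unit_inv_right[OF c] by (simp flip: mult.assoc)
            ultimately show "e \<in> (*) c ` char_stab \<chi>" by blast
          next
            assume "e \<in> (*) c ` char_stab \<chi>"
            then obtain h where h: "h \<in> char_stab \<chi>" "e = c * h" by blast
            show "\<forall>b. \<chi> (c * b) = \<chi> (e * b)"
              using stab_char[OF h(1), of "c * b" for b] by (simp add: h(2) mult_ac)
          qed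
          ultimately show ?thesis by simp
        qed
        have "fun_of G c = (\<Sum>e | e dvd 1. \<Sum>b\<in>UNIV.
            (fun_of F e / K * fun_of f (c0 * unit_inv e * c)) * \<chi> ((c - e) * b))"
          unfolding G_def fun_of_sum t_def
        proof (intro sum.cong refl)
          fix e b :: 'r assume "e \<in> {e. e dvd 1}"
          then have "Aff (c0 * unit_inv e) b \<in> aff_units"
            using c0 by (simp add: aff_units_iff unit_mult_iff unit_inv_unit)
          moreover have "\<chi> ((c - e) * b) = \<chi> (- e * b) * \<chi> (c * b)"
            by (simp add: algebra_simps flip: character_add[OF char])
          ultimately show "fun_of (act W (Poly_Mapping.single (Aff (c0 * unit_inv e) b)
                (fun_of F e / K * \<chi> (- e * b))) f) c
              = fun_of F e / K * fun_of f (c0 * unit_inv e * c) * \<chi> ((c - e) * b)"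
            using fun_of_act[OF f_W _ c] by simp
        qed
        also have "\<dots> = (\<Sum>e | e dvd 1. if e \<in> (*) c ` char_stab \<chi>
            then fun_of F e / K * fun_of f (c0 * unit_inv e * c) * n else 0)"
          unfolding sum_distrib_left[symmetric] character_sum[OF char] n_def
          by (intro sum.cong) (auto simp: coset)
        also have "\<dots> = (\<Sum>e\<in>(*) c ` char_stab \<chi>. fun_of F e / K * fun_of f (c0 * unit_inv e * c) * n)"
          using c stab_unit[of _ \<chi>]
          by (intro sum.mono_neutral_cong_right) (auto simp: unit_mult_iff)
        also have "\<dots> = (\<Sum>h\<in>char_stab \<chi>. fun_of F (c * h) / K * fun_of f (c0 * unit_inv (c * h) * c) * n)"
        proof (subst sum.reindex)
          show "inj_on ((*) c) (char_stab \<chi>)"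
          proof (rule inj_onI)
            fix x y assume "c * x = c * y"
            then have "unit_inv c * (c * x) = unit_inv c * (c * y)" by simp
            then show "x = y" using unit_inv_left[OF c] by (simp flip: mult.assoc)
          qed
        qed simp
        also have "\<dots> = (\<Sum>h\<in>char_stab \<chi>. fun_of F c / s)"
        proof (intro sum.cong refl)
          fix h assume h: "h \<in> char_stab \<chi>"
          have "c0 * unit_inv (c * h) * c = c0 * (c * unit_inv c) * unit_inv h"
            using c stab_unit[OF h] by (simp add: unit_inv_mult mult_ac)
          then have "fun_of f (c0 * unit_inv (c * h) * c) = \<rho> (unit_inv h) * fun_of f c0"
            using fun_of_stab[OF f_W c0(1) stab_inv[OF h]] c by (simp add: unit_inv_right)
          moreover have "fun_of F (c * h) = \<rho> h * fun_of F c"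
            by (rule fun_of_stab[OF F c h])
          ultimately have "fun_of F (c * h) / K * fun_of f (c0 * unit_inv (c * h) * c) * n
              = (\<rho> h * \<rho> (unit_inv h)) * (fun_of F c * fun_of f c0 * n / K)"
            by simp
          also have "\<dots> = fun_of F c / s"
            using rho_inv[OF h] n0 c0(2) by (simp add: K_def)
          finally show "fun_of F (c * h) / K * fun_of f (c0 * unit_inv (c * h) * c) * n = fun_of F c / s" .
        qed
        also have "\<dots> = fun_of F c"
          using s0 by (simp add: s_def)
        finally show ?thesis .
      qed
      then have "G = F"
        using G_N N_sub F by (intro W_eqI) auto
      with G_N show ?thesis by simp
    qed
    then show ?thesis using N_sub by blast
  qed simp
qed

lemma exists_nonzero_val: "\<exists>f\<in>car W. \<exists>c. c dvd 1 \<and> fun_of f c \<noteq> 0"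
proof (rule ccontr)
  assume contra: "\<not> ?thesis"
  have "f = 0" if "f \<in> car W" for f
    using contra that by (intro W_eqI W_zero) (auto simp: fun_of_zero)
  then have "car W = {0}" using W_zero by blast
  then show False using W_simple by (simp add: simple_module_def)
qed

end


section \<open>The extension attached to an irreducible element\<close>

text \<open>
  The data behind one arrow. The unit \<open>w\<close> absorbs the choice of representatives in the two orbits. The
  last two assumptions hold for every \<open>p \<in> \<mm> - \<mm>\<^sup>2\<close>.
\<close>

locale arrow = A: affine_rep \<chi> \<rho> + B: affine_rep \<chi>' \<rho>'
  for \<chi> \<rho> \<chi>' \<rho>' :: "'r::{finite,comm_ring_1} \<Rightarrow> complex" +
  fixes p w :: 'r
  assumes w_unit: "w dvd 1" and chars: "\<chi>' (p * x) = \<chi> (w * x)"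
    and ann: "a * p = 0 \<Longrightarrow> 1 + a \<in> char_stab \<chi> \<and> \<rho> (1 + a) = 1"
    and rho: "u \<in> char_stab \<chi>' \<Longrightarrow> \<rho> u = \<rho>' u"
    and p_nonunit: "\<not> p dvd 1"
    and p_irred: "\<not> a dvd 1 \<Longrightarrow> \<not> b dvd 1 \<Longrightarrow> e dvd 1 \<Longrightarrow> a * b \<noteq> e * p"
begin

text \<open>
  The function \<open>\<phi>(w \<sqdot>)\<close> acted upon by \<open>x \<mapsto> e x + b\<close>, where the affine map is \<open>x \<mapsto> e p x + b\<close>.
\<close>

definition D :: "'r aff \<Rightarrow> ('r aff \<Rightarrow>\<^sub>0 complex) \<Rightarrow> 'r aff \<Rightarrow>\<^sub>0 complex" where
  "D g f = B.of_fun (\<lambda>c. if \<exists>e. e dvd 1 \<and> slope g = e * p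
     then \<chi>' (c * shift g) * A.fun_of f (w * c * (SOME e. e dvd 1 \<and> slope g = e * p)) else 0)"

text \<open>
  Two units \<open>e\<close> and \<open>e'\<close> with \<open>e p = e' p\<close> differ by a factor \<open>1 + a\<close> with \<open>a p = 0\<close>, and \<open>\<rho>\<close> is
  trivial there.
\<close>

lemma fun_of_unit_choice:
  assumes f: "f \<in> car A.W" and x: "x dvd 1" and e: "e dvd 1" and eq: "e * p = e' * p"
  shows "A.fun_of f (x * e) = A.fun_of f (x * e')"
proof -
  define a where "a = unit_inv e * e' - 1"
  have "a * p = unit_inv e * (e' * p) - p"
    by (simp add: a_def algebra_simps)
  also have "\<dots> = unit_inv e * e * p - p"
    by (simp only: eq[symmetric] mult.assoc)
  finally have "a * p = 0"
    using unit_inv_left[OF e] by simp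
  note a = ann[OF this]
  have "x * e' = x * (e * unit_inv e) * e'"
    by (simp add: unit_inv_right[OF e])
  also have "\<dots> = x * e * (1 + a)"
    by (simp add: a_def mult.assoc)
  finally show ?thesis
    using A.fun_of_stab[OF f, of "x * e" "1 + a"] a x e by (simp add: unit_mult_iff)
qed

lemma D_equivariant:
  assumes f: "f \<in> car A.W"
  shows "B.equivariant (\<lambda>c. if \<exists>e. e dvd 1 \<and> slope g = e * p
     then \<chi>' (c * shift g) * A.fun_of f (w * c * (SOME e. e dvd 1 \<and> slope g = e * p)) else 0)"
proof (cases "\<exists>e. e dvd 1 \<and> slope g = e * p")
  case True
  define e where "e = (SOME e. e dvd 1 \<and> slope g = e * p)"
  have e: "e dvd 1" "slope g = e * p"
    using someI_ex[OF True] by (auto simp: e_def)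
  have "\<chi>' (c * h * shift g) * A.fun_of f (w * (c * h) * e)
      = \<rho>' h * (\<chi>' (c * shift g) * A.fun_of f (w * c * e))" if "c dvd 1" "h \<in> char_stab \<chi>'" for c h
  proof -
    have "\<chi>' (c * h * shift g) = \<chi>' (c * shift g)"
      using stab_char[OF that(2), of "c * shift g"] by (simp only: mult_ac)
    moreover have "w * (c * h) * e = (w * c * e) * h"
      by (simp only: mult_ac)
    moreover have "A.fun_of f ((w * c * e) * h) = \<rho>' h * A.fun_of f (w * c * e)"
      using A.fun_of_stab[OF f, of "w * c * e" h] that e(1) w_unit char_stab_subset[of w \<chi>' p \<chi>, OF w_unit chars]
      by (auto simp: unit_mult_iff rho)
    ultimately show ?thesis by (simp only: mult_ac)
  qed
  then show ?thesis
    using True unfolding B.equivariant_def e_def by (simp only: if_True) blast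
next
  case False
  then show ?thesis
    unfolding B.equivariant_def by (simp only: if_False mult_zero_right simp_thms)
qed

lemma D_in: "f \<in> car A.W \<Longrightarrow> D g f \<in> car B.W"
  unfolding D_def by (intro B.of_fun_in D_equivariant)

lemma D_val:
  assumes "f \<in> car A.W" "c dvd 1" "e dvd 1" "slope g = e * p"
  shows "B.fun_of (D g f) c = \<chi>' (c * shift g) * A.fun_of f (w * c * e)"
proof -
  have ex: "\<exists>e. e dvd 1 \<and> slope g = e * p" using assms(3,4) by blast
  define e' where "e' = (SOME e. e dvd 1 \<and> slope g = e * p)"
  have e': "e' dvd 1" "slope g = e' * p"
    using someI_ex[OF ex] by (auto simp: e'_def)
  have "A.fun_of f (w * c * e) = A.fun_of f (w * c * e')"
    using assms w_unit e' by (intro fun_of_unit_choice) (auto simp: unit_mult_iff)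
  then show ?thesis
    using ex assms(2) by (simp only: D_def B.fun_of_of_fun e'_def if_True)
qed

lemma D_val_zero: "\<not> (\<exists>e. e dvd 1 \<and> slope g = e * p) \<Longrightarrow> c dvd 1 \<Longrightarrow> B.fun_of (D g f) c = 0"
  by (simp only: D_def B.fun_of_of_fun if_False)

lemma D_eq_zero: "f \<in> car A.W \<Longrightarrow> \<not> (\<exists>e. e dvd 1 \<and> slope g = e * p) \<Longrightarrow> D g f = 0"
  by (intro B.W_eqI D_in B.W_zero) (simp_all add: D_val_zero B.fun_of_zero)

lemma D_at_unit: "f \<in> car A.W \<Longrightarrow> g \<in> aff_units \<Longrightarrow> D g f = 0"
  using p_nonunit by (intro D_eq_zero) (auto simp: aff_units_slope unit_mult_iff)

lemma D_linear:
  assumes "f \<in> car A.W" "f' \<in> car A.W"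
  shows "D g (f + f') = D g f + D g f'"
    and "D g (act A.W (Poly_Mapping.single 0 \<alpha>) f) = act B.W (Poly_Mapping.single 0 \<alpha>) (D g f)"
proof -
  note in_A = assms module_act[OF A.W_left_module assms(1)] A.W_add[OF assms]
  note in_B = D_in[OF assms(1)] D_in[OF assms(2)] D_in[OF in_A(3)] D_in[OF in_A(4)]
  show "D g (f + f') = D g f + D g f'"
  proof (rule B.W_eqI)
    fix c :: 'r assume c: "c dvd 1"
    show "B.fun_of (D g (f + f')) c = B.fun_of (D g f + D g f') c"
    proof (cases "\<exists>e. e dvd 1 \<and> slope g = e * p")
      case True
      then show ?thesis
        using in_A c by (auto simp: B.fun_of_add D_val A.fun_of_add distrib_left)
    qed (simp add: B.fun_of_add D_val_zero c)
  qed (use in_B B.W_add in auto)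
  show "D g (act A.W (Poly_Mapping.single 0 \<alpha>) f) = act B.W (Poly_Mapping.single 0 \<alpha>) (D g f)"
  proof (rule B.W_eqI)
    fix c :: 'r assume c: "c dvd 1"
    show "B.fun_of (D g (act A.W (Poly_Mapping.single 0 \<alpha>) f)) c
        = B.fun_of (act B.W (Poly_Mapping.single 0 \<alpha>) (D g f)) c"
    proof (cases "\<exists>e. e dvd 1 \<and> slope g = e * p")
      case True
      then obtain e where e: "e dvd 1" "slope g = e * p" by blast
      then show ?thesis
        using in_A in_B c w_unit
        by (simp only: D_val[OF _ c e] B.fun_of_scale[OF _ c])
           (simp add: A.fun_of_scale unit_mult_iff)
    qed (simp add: B.fun_of_scale in_B D_val_zero c)
  qed (use in_B module_act[OF B.W_left_module] in auto)
qed

text \<open>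
  If both maps are units, or both are nonunits, all terms vanish, in the second case because the product
  is not associated to \<open>p\<close>. If only \<open>g\<close> is a unit, the identity says that \<open>D\<close> commutes with the action
  on \<open>W'\<close>; if only \<open>h\<close> is one, it is the compatibility of \<open>\<chi>' (p x) = \<chi> (w x)\<close> with translations.
\<close>

lemma D_mult:
  assumes f: "f \<in> car A.W"
  shows "D (g + h) f = act B.W (Poly_Mapping.single g 1) (D h f)
    + D g (act A.W (Poly_Mapping.single h 1) f)"
proof (cases "g \<in> aff_units")
  case g: True
  show ?thesis
  proof (cases "h \<in> aff_units")
    case True
    then show ?thesis
      using g f by (simp add: D_at_unit aff_units_add_iff module_act[OF A.W_left_module]
          act_zero_right[OF B.W_left_module])
  next
    case False
    have "D g (act A.W (Poly_Mapping.single h 1) f) = 0"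
      using g f by (intro D_at_unit module_act[OF A.W_left_module])
    moreover have "D (g + h) f = act B.W (Poly_Mapping.single g 1) (D h f)"
    proof (rule B.W_eqI)
      fix c :: 'r assume c: "c dvd 1"
      have a: "slope g dvd 1" using g by (simp add: aff_units_slope)
      show "B.fun_of (D (g + h) f) c = B.fun_of (act B.W (Poly_Mapping.single g 1) (D h f)) c"
      proof (cases "\<exists>e. e dvd 1 \<and> slope h = e * p")
        case True
        then obtain e where e: "e dvd 1" "slope h = e * p" by blast
        have "slope g * e dvd 1" "slope (g + h) = (slope g * e) * p"
          using a e by (simp_all add: slope_add unit_mult_iff mult.assoc)
        then have "B.fun_of (D (g + h) f) c = \<chi>' (c * shift (g + h)) * A.fun_of f (w * c * (slope g * e))"
          by (rule D_val[OF f c])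
        also have "\<chi>' (c * shift (g + h)) = \<chi>' (c * shift g) * \<chi>' (slope g * c * shift h)"
        proof -
          have "c * shift (g + h) = c * shift g + slope g * c * shift h"
            by (simp add: shift_add algebra_simps)
          then show ?thesis by (simp only: character_add[OF B.char])
        qed
        also have "w * c * (slope g * e) = w * (slope g * c) * e"
          by (simp only: mult_ac)
        finally show ?thesis
          using a c by (simp add: B.fun_of_act[OF D_in[OF f] g c] D_val[OF f _ e] unit_mult_iff)
      next
        case False
        have "\<not> (\<exists>e. e dvd 1 \<and> slope (g + h) = e * p)"
        proof
          assume "\<exists>e. e dvd 1 \<and> slope (g + h) = e * p"
          then obtain e where e: "e dvd 1" "slope g * slope h = e * p"
            by (auto simp: slope_add)
          have "slope h = unit_inv (slope g) * slope g * slope h"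
            using a by (simp add: unit_inv_left)
          also have "\<dots> = unit_inv (slope g) * e * p"
            using e(2) by (simp only: mult.assoc)
          finally have "slope h = unit_inv (slope g) * e * p" .
          moreover have "unit_inv (slope g) * e dvd 1"
            using a e(1) by (simp add: unit_mult_iff unit_inv_unit)
          ultimately show False
            using False by blast
        qed
        then show ?thesis
          using False a c by (simp add: B.fun_of_act[OF D_in[OF f] g c] D_val_zero unit_mult_iff)
      qed
    qed (use D_in[OF f] module_act[OF B.W_left_module] in auto)
    ultimately show ?thesis by simp
  qed
next
  case g: False
  then have g_zero: "act B.W (Poly_Mapping.single g 1) (D h f) = 0"
    by (rule B.act_W_nonunit)
  show ?thesis
  proof (cases "h \<in> aff_units")
    case h: True
    define f' where "f' = act A.W (Poly_Mapping.single h 1) f"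
    have f': "f' \<in> car A.W" unfolding f'_def by (intro module_act[OF A.W_left_module] f)
    have a: "slope h dvd 1" using h by (simp add: aff_units_slope)
    have "D (g + h) f = D g f'"
    proof (rule B.W_eqI)
      fix c :: 'r assume c: "c dvd 1"
      show "B.fun_of (D (g + h) f) c = B.fun_of (D g f') c"
      proof (cases "\<exists>e. e dvd 1 \<and> slope g = e * p")
        case True
        then obtain e where e: "e dvd 1" "slope g = e * p" by blast
        have "e * slope h dvd 1" "slope (g + h) = (e * slope h) * p"
          using a e by (simp_all add: slope_add unit_mult_iff mult_ac)
        then have "B.fun_of (D (g + h) f) c = \<chi>' (c * shift (g + h)) * A.fun_of f (w * c * (e * slope h))"
          by (rule D_val[OF f c])
        also have "\<chi>' (c * shift (g + h)) = \<chi>' (c * shift g) * \<chi>' (p * (e * c * shift h))"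
        proof -
          have "c * shift (g + h) = c * shift g + p * (e * c * shift h)"
            by (simp add: shift_add e(2) algebra_simps)
          then show ?thesis by (simp only: character_add[OF B.char])
        qed
        also have "\<chi>' (p * (e * c * shift h)) = \<chi> (w * c * e * shift h)"
          by (simp only: chars mult.assoc mult.left_commute[of c e])
        also have "w * c * (e * slope h) = slope h * (w * c * e)"
          by (simp only: mult_ac)
        finally have "B.fun_of (D (g + h) f) c = \<chi>' (c * shift g)
            * (\<chi> (w * c * e * shift h) * A.fun_of f (slope h * (w * c * e)))"
          by (simp only: mult.assoc)
        moreover have "A.fun_of f' (w * c * e) = \<chi> (w * c * e * shift h) * A.fun_of f (slope h * (w * c * e))"
          using c e w_unit by (simp add: f'_def A.fun_of_act[OF f h] unit_mult_iff)
        ultimately show ?thesis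
          by (simp only: D_val[OF f' c e])
      next
        case False
        have "\<not> (\<exists>e. e dvd 1 \<and> slope (g + h) = e * p)"
        proof
          assume "\<exists>e. e dvd 1 \<and> slope (g + h) = e * p"
          then obtain e where e: "e dvd 1" "slope g * slope h = e * p"
            by (auto simp: slope_add)
          have "slope g = unit_inv (slope h) * (slope g * slope h)"
            using a by (simp add: mult.left_commute[of "unit_inv (slope h)"] unit_inv_left)
          also have "\<dots> = unit_inv (slope h) * e * p"
            using e(2) by (simp only: mult.assoc)
          finally have "slope g = unit_inv (slope h) * e * p" .
          moreover have "unit_inv (slope h) * e dvd 1"
            using a e(1) by (simp add: unit_mult_iff unit_inv_unit)
          ultimately show False
            using False by blast
        qed
        then show ?thesis
          using False c by (simp add: D_val_zero)
      qed
    qed (use D_in f f' in auto)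
    then show ?thesis by (simp add: g_zero f'_def)
  next
    case h: False
    have "D (g + h) f = 0"
      using f g h p_irred by (intro D_eq_zero) (auto simp: slope_add aff_units_slope)
    moreover have "D g 0 = 0"
      using D_linear(1)[OF A.W_zero A.W_zero, of g] by simp
    ultimately show ?thesis
      by (simp add: g_zero A.act_W_nonunit h)
  qed
qed

sublocale module_cocycle A.W B.W D
  by unfold_locales (rule A.W_left_module B.W_left_module D_in D_linear D_mult; assumption)+

end


section \<open>The arrow out of the trivial module\<close>

lemma act_trivial:
  "act trivial_module a z = (\<Sum>g\<in>Poly_Mapping.keys a. Poly_Mapping.lookup a g * z)"
  "car trivial_module = UNIV"
  by (simp_all add: trivial_module_def)

lemma act_trivial_single: "act trivial_module (Poly_Mapping.single g c) z = c * z"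
  by (cases "c = 0") (simp_all add: act_trivial)

lemma act_trivial_add: "act trivial_module (a + b) z = act trivial_module a z + act trivial_module b z"
  unfolding act_trivial by (rule setsum_keys_plus_distrib) (simp_all add: distrib_right)

lemma act_trivial_zero: "act trivial_module 0 z = 0"
  by (simp add: act_trivial)

lemma act_trivial_right: "act trivial_module a (y + z) = act trivial_module a y + act trivial_module a z"
  by (simp add: act_trivial distrib_left sum.distrib)

lemma act_trivial_zero_right: "act trivial_module a 0 = 0"
  by (simp add: act_trivial)

lemma trivial_left_module:
  "left_module (trivial_module :: ('r::comm_ring_1 aff \<Rightarrow>\<^sub>0 complex, complex) lmodule)"
proof -
  have mult: "act trivial_module (a * b) z = act trivial_module a (act trivial_module b z)"
    for a b :: "'r aff \<Rightarrow>\<^sub>0 complex" and z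
  proof (induction a rule: poly_mapping_add_induct)
    case (single g \<alpha>)
    show ?case
      by (induction b rule: poly_mapping_add_induct)
         (simp_all add: mult_single act_trivial_single act_trivial_zero act_trivial_zero_right
            distrib_left act_trivial_add)
  qed (simp_all add: act_trivial_zero distrib_right act_trivial_add)
  have "act trivial_module (1 :: 'r aff \<Rightarrow>\<^sub>0 complex) z = z" for z
    using act_trivial_single[of 0 1 z] by simp
  with mult show ?thesis
    unfolding left_module_def by (simp add: act_trivial(2) act_trivial_right act_trivial_add)
qed

lemma trivial_simple:
  "simple_module (trivial_module :: ('r::comm_ring_1 aff \<Rightarrow>\<^sub>0 complex, complex) lmodule)"
  unfolding simple_module_def
proof (intro conjI allI impI)
  show "car (trivial_module :: ('r aff \<Rightarrow>\<^sub>0 complex, complex) lmodule) \<noteq> {0}"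
    unfolding act_trivial(2) by (metis UNIV_I singletonD zero_neq_one)
next
  fix N assume N: "submodule N (trivial_module :: ('r aff \<Rightarrow>\<^sub>0 complex, complex) lmodule)"
  show "N = {0} \<or> N = car (trivial_module :: ('r aff \<Rightarrow>\<^sub>0 complex, complex) lmodule)"
  proof (cases "N = {0}")
    case False
    moreover have "0 \<in> N" using N by (simp add: submodule_def)
    ultimately obtain z where z: "z \<in> N" "z \<noteq> 0" by blast
    have "y \<in> N" for y
    proof -
      have "act trivial_module (Poly_Mapping.single (0 :: 'r aff) (y / z)) z \<in> N"
        using N z(1) unfolding submodule_def by blast
      then show ?thesis using z(2) by (simp add: act_trivial_single)
    qed
    then show ?thesis by (auto simp: act_trivial(2))
  qed simp
qed (rule trivial_left_module)

text \<open>
  In a local ring the nonunits form the maximal ideal, so that \<open>\<chi>\<close> is a nontrivial character of the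
  residue field.
\<close>

locale trivial_arrow = affine_rep \<chi> "\<lambda>_. 1" for \<chi> :: "'r::{finite,comm_ring_1} \<Rightarrow> complex" +
  assumes nonunit_ker: "\<not> a dvd 1 \<Longrightarrow> \<chi> a = 1" and nontrivial: "\<exists>b. \<chi> b \<noteq> 1"
begin

text \<open>
  Up to the coordinates on \<open>W\<close>, this is the difference of the points \<open>b\<close> and \<open>0\<close> in the permutation
  module on the residue field: the map \<open>x \<mapsto> a x + b\<close> moves the base point \<open>0\<close> to \<open>b\<close>.
\<close>

definition D :: "'r aff \<Rightarrow> complex \<Rightarrow> 'r aff \<Rightarrow>\<^sub>0 complex" where
  "D g z = of_fun (\<lambda>c. z * (\<chi> (c * shift g) - 1))"

lemma D_in: "D g z \<in> car W"
  unfolding D_def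
proof (rule of_fun_in, unfold equivariant_def, intro allI impI)
  fix c h assume "h \<in> char_stab \<chi>"
  then show "z * (\<chi> (c * h * shift g) - 1) = 1 * (z * (\<chi> (c * shift g) - 1))"
    using stab_char[of h \<chi> "c * shift g"] by (simp add: mult_ac)
qed

lemma fun_of_D: "c dvd 1 \<Longrightarrow> fun_of (D g z) c = z * (\<chi> (c * shift g) - 1)"
  by (simp add: D_def fun_of_of_fun)

sublocale module_cocycle trivial_module W D
proof
  show "left_module (trivial_module :: ('r aff \<Rightarrow>\<^sub>0 complex, complex) lmodule)" "left_module W"
    by (rule trivial_left_module W_left_module)+
next
  fix g h and x y \<alpha> :: complex
  show "D g x \<in> car W" by (rule D_in)
  show "D g (x + y) = D g x + D g y"
    by (rule W_eqI) (simp_all add: D_in W_add fun_of_D fun_of_add algebra_simps)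
  show "D g (act trivial_module (Poly_Mapping.single 0 \<alpha>) x) = act W (Poly_Mapping.single 0 \<alpha>) (D g x)"
    by (rule W_eqI)
       (simp_all add: D_in module_act[OF W_left_module] fun_of_D fun_of_scale act_trivial_single)
  show "D (g + h) x = act W (Poly_Mapping.single g 1) (D h x)
      + D g (act trivial_module (Poly_Mapping.single h 1) x)"
  proof (rule W_eqI)
    fix c :: 'r assume c: "c dvd 1"
    have shift: "\<chi> (c * shift (g + h)) = \<chi> (c * shift g) * \<chi> (slope g * c * shift h)"
    proof -
      have "c * shift (g + h) = c * shift g + slope g * c * shift h"
        by (simp add: shift_add algebra_simps)
      then show ?thesis by (simp only: character_add[OF char])
    qed
    show "fun_of (D (g + h) x) c = fun_of (act W (Poly_Mapping.single g 1) (D h x)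
        + D g (act trivial_module (Poly_Mapping.single h 1) x)) c"
    proof (cases "g \<in> aff_units")
      case True
      then have "slope g * c dvd 1"
        using c by (simp add: aff_units_slope unit_mult_iff)
      then show ?thesis
        using True c
        by (simp add: fun_of_add fun_of_D fun_of_act D_in act_trivial_single shift algebra_simps)
    next
      case False
      then have "\<chi> (slope g * c * shift h) = 1"
        by (intro nonunit_ker) (simp add: aff_units_slope unit_mult_iff)
      then show ?thesis
        using False c
        by (simp add: fun_of_add fun_of_D act_W_nonunit fun_of_zero act_trivial_single shift)
    qed
  qed (simp_all add: D_in W_add module_act[OF W_left_module])
qed

text \<open>
  The constant maps \<open>x \<mapsto> b\<close> act as the identity on the trivial module and as zero on \<open>W\<close>, so a
  coboundary takes the same value \<open>- \<phi> 1\<close> at all of them.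
\<close>

lemma ext_trivial: "1 \<le> ext1_dim (trivial_module :: ('r aff \<Rightarrow>\<^sub>0 complex, complex) lmodule) W"
proof -
  have "enat (card {()}) \<le> ext1_dim (trivial_module :: ('r aff \<Rightarrow>\<^sub>0 complex, complex) lmodule) W"
  proof (rule card_le_ext1_dim[where D = "\<lambda>_. D"])
    fix c :: "unit \<Rightarrow> complex" and \<phi> :: "complex \<Rightarrow> 'r aff \<Rightarrow>\<^sub>0 complex"
    assume \<phi>: "\<And>x. x \<in> car (trivial_module :: ('r aff \<Rightarrow>\<^sub>0 complex, complex) lmodule) \<Longrightarrow> \<phi> x \<in> car W"
      and rel: "\<And>g x. x \<in> car (trivial_module :: ('r aff \<Rightarrow>\<^sub>0 complex, complex) lmodule) \<Longrightarrow>
        (\<Sum>i\<in>{()}. act W (Poly_Mapping.single 0 (c i)) (D g x))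
          + \<phi> (act trivial_module (Poly_Mapping.single g 1) x) = act W (Poly_Mapping.single g 1) (\<phi> x)"
    obtain b where b: "\<chi> b \<noteq> 1" using nontrivial by blast
    have "\<not> (0::'r) dvd 1"
    proof
      assume "(0::'r) dvd 1"
      then have "b = 0" by (metis dvd_0_left mult_1 mult_zero_left)
      then show False using b character_zero[OF char] by simp
    qed
    then have non: "Aff 0 d \<notin> aff_units" for d :: 'r
      by (simp add: aff_units_iff)
    have eq: "c () * (\<chi> d - 1) + fun_of (\<phi> 1) 1 = 0" for d
      using arg_cong[OF rel[of 1 "Aff 0 d"], of "\<lambda>f. fun_of f 1"]
      by (simp add: act_trivial act_trivial_single fun_of_add fun_of_scale D_in fun_of_D act_W_nonunit non fun_of_zero)
    have "fun_of (\<phi> 1) 1 = 0"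
      using eq[of 0] by (simp add: character_zero[OF char])
    then show "\<forall>i\<in>{()}. c i = 0"
      using eq[of b] b by simp
  qed (simp_all add: module_cocycle_axioms trivial_left_module W_left_module)
  then show ?thesis by (simp add: one_enat_def)
qed

end


section \<open>Finite local rings\<close>

lemma ideal_minus: "is_ideal I \<Longrightarrow> x \<in> I \<Longrightarrow> - x \<in> I"
  unfolding is_ideal_def by (metis mult_minus1)

lemma maximal_ideal_of_local: "local_ring_with \<mm> \<Longrightarrow> is_maximal_ideal \<mm>"
  by (simp add: local_ring_with_def)

text \<open>
  The ideal generated by a nonunit lies in a maximal ideal because the ring is finite, and \<open>\<mm>\<close> is the
  only one.
\<close>

lemma local_nonunits:
  fixes \<mm> :: "'r::{finite,comm_ring_1} set"
  assumes loc: "local_ring_with \<mm>"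
  shows "x \<in> \<mm> \<longleftrightarrow> \<not> x dvd 1"
proof
  assume x: "x \<in> \<mm>"
  have ideal: "is_ideal \<mm>" "\<mm> \<noteq> UNIV"
    using maximal_ideal_of_local[OF loc] by (simp_all add: is_maximal_ideal_def)
  show "\<not> x dvd 1"
  proof
    assume "x dvd 1"
    then have "y = y * unit_inv x * x" for y
      by (simp add: mult.assoc unit_inv_left)
    then have "y \<in> \<mm>" for y
      using ideal(1) x unfolding is_ideal_def by metis
    with ideal(2) show False by blast
  qed
next
  assume x: "\<not> x dvd 1"
  define I where "I = range (\<lambda>a. a * x)"
  define S where "S = {J. is_ideal J \<and> J \<noteq> UNIV \<and> I \<subseteq> J}"
  have "is_ideal I"
    unfolding is_ideal_def I_def
    by (auto intro: range_eqI[of _ _ 0]) (metis distrib_right rangeI, metis mult.assoc rangeI)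
  moreover have "1 \<notin> I"
    using x by (auto simp: I_def) (metis dvd_triv_right)
  ultimately have "I \<in> S" by (auto simp: S_def)
  then obtain J where J: "J \<in> S" "I \<subseteq> J" "\<forall>K\<in>S. J \<subseteq> K \<longrightarrow> J = K"
    using finite_has_maximal2[of S I] by auto
  have "is_maximal_ideal J"
    unfolding is_maximal_ideal_def
  proof (intro conjI allI impI)
    show "is_ideal J" "J \<noteq> UNIV" using J(1) by (auto simp: S_def)
  next
    fix K assume "is_ideal K \<and> J \<subseteq> K"
    then show "K = J \<or> K = UNIV"
      using J by (cases "K = UNIV") (auto simp: S_def)
  qed
  then have "J = \<mm>" using loc by (simp add: local_ring_with_def)
  moreover have "x \<in> I" unfolding I_def by (rule range_eqI[of _ _ 1]) simp
  ultimately show "x \<in> \<mm>" using J(2) by blast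
qed

lemma ideal_square_product:
  assumes "x \<in> I" "y \<in> I"
  shows "a * (x * y) \<in> ideal_square I"
  using assms unfolding ideal_square_def is_ideal_def by blast

text \<open>
  Enlarge \<open>H0\<close> to a maximal proper additive subgroup \<open>H\<close> and take \<open>x\<close> outside \<open>H\<close>. The quotient by \<open>H\<close>
  is generated by \<open>x\<close>, hence cyclic of some order \<open>n > 1\<close>, and embeds into the roots of unity.
\<close>

lemma exists_character:
  fixes H0 :: "'r::{finite,comm_ring_1} set"
  assumes ideal: "is_ideal H0" and proper: "H0 \<noteq> UNIV"
  shows "\<exists>\<chi>. add_character \<chi> \<and> H0 \<subseteq> char_ker \<chi> \<and> char_ker \<chi> \<noteq> UNIV"
proof -
  define subgrp where "subgrp H \<longleftrightarrow> (0::'r) \<in> H \<and> (\<forall>a\<in>H. \<forall>b\<in>H. a + b \<in> H) \<and> (\<forall>a\<in>H. - a \<in> H)" for H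
  define S where "S = {H. subgrp H \<and> H \<noteq> UNIV \<and> H0 \<subseteq> H}"
  have "H0 \<in> S"
    using ideal proper ideal_minus[OF ideal] unfolding S_def subgrp_def is_ideal_def by blast
  then obtain H where H: "H \<in> S" "H0 \<subseteq> H" and max: "\<forall>K\<in>S. H \<subseteq> K \<longrightarrow> H = K"
    using finite_has_maximal2[of S H0] by auto
  from H(1) have H_0: "0 \<in> H" and H_add: "\<And>a b. a \<in> H \<Longrightarrow> b \<in> H \<Longrightarrow> a + b \<in> H"
    and H_minus: "\<And>a. a \<in> H \<Longrightarrow> - a \<in> H" and "H \<noteq> UNIV"
    unfolding S_def subgrp_def by blast+
  then obtain x where x: "x \<notin> H" by blast
  have H_nat: "of_nat k * a \<in> H" if "a \<in> H" for a k
    by (induction k) (use that H_0 H_add in \<open>auto simp: distrib_right\<close>)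
  have H_int: "of_int k * a \<in> H" if "a \<in> H" for a k
    by (cases k rule: int_cases2) (use that H_nat H_minus in auto)
  have span: "\<exists>k::int. \<exists>h\<in>H. y = h + of_int k * x" for y
  proof -
    define K where "K = {h + of_int k * x | h k. h \<in> H}"
    have "subgrp K"
      unfolding subgrp_def
    proof (intro conjI ballI)
      show "0 \<in> K" unfolding K_def using H_0 by (intro CollectI exI[of _ 0]) simp
    next
      fix a b assume "a \<in> K" "b \<in> K"
      then obtain h k h' k' where "a = h + of_int k * x" "b = h' + of_int k' * x" "h \<in> H" "h' \<in> H"
        by (auto simp: K_def)
      then show "a + b \<in> K"
        unfolding K_def
        by (intro CollectI exI[of _ "h + h'"] exI[of _ "k + k'"]) (simp add: H_add algebra_simps)
    next
      fix a assume "a \<in> K"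
      then obtain h k where "a = h + of_int k * x" "h \<in> H"
        by (auto simp: K_def)
      then show "- a \<in> K"
        unfolding K_def
        by (intro CollectI exI[of _ "- h"] exI[of _ "- k"]) (simp add: H_minus algebra_simps)
    qed
    moreover have "H \<subseteq> K"
    proof
      fix h assume "h \<in> H"
      then show "h \<in> K" unfolding K_def by (intro CollectI exI[of _ h] exI[of _ 0]) simp
    qed
    moreover have "x \<in> K"
      unfolding K_def using H_0 by (intro CollectI exI[of _ 0] exI[of _ 1]) simp
    ultimately have "K = UNIV"
      using max x H(2) by (auto simp: S_def)
    then show ?thesis unfolding K_def by blast
  qed
  have "\<exists>n>0. of_nat n * x \<in> H"
  proof -
    have "\<not> inj (\<lambda>n::nat. of_nat n * x)"
    proof
      assume "inj (\<lambda>n::nat. of_nat n * x)"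
      then have "finite (UNIV :: nat set)" by (rule finite_imageD[rotated]) simp
      then show False by simp
    qed
    then obtain i j :: nat where "i < j" "of_nat i * x = of_nat j * x"
      unfolding inj_on_def by (metis linorder_neqE_nat)
    then have "of_nat (j - i) * x = 0"
      by (simp add: of_nat_diff left_diff_distrib)
    with \<open>i < j\<close> H_0 show ?thesis by (intro exI[of _ "j - i"]) simp
  qed
  note ex = this
  define n where "n = (LEAST n. n > 0 \<and> of_nat n * x \<in> H)"
  have n: "n > 0" "of_nat n * x \<in> H"
    using LeastI_ex[OF ex] by (simp_all add: n_def)
  have least: "of_nat m * x \<notin> H" if "0 < m" "m < n" for m
    using not_less_Least[of m "\<lambda>n. n > 0 \<and> of_nat n * x \<in> H"] that by (simp add: n_def)
  have n1: "n \<noteq> 1" using n x by auto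
  have period: "int n dvd k" if "of_int k * x \<in> H" for k
  proof (rule ccontr)
    assume "\<not> int n dvd k"
    define m where "m = nat (k mod int n)"
    have m: "int m = k mod int n" "0 < m" "m < n"
    proof -
      have "0 \<le> k mod int n" "k mod int n < int n" "k mod int n \<noteq> 0"
        using n(1) \<open>\<not> int n dvd k\<close> by (simp_all add: dvd_eq_mod_eq_0)
      then show "int m = k mod int n" "0 < m" "m < n" unfolding m_def by linarith+
    qed
    have k: "int m + (k div int n) * int n = k"
      using m(1) by simp
    have "of_int (int m + (k div int n) * int n) * x = of_nat m * x + of_int (k div int n) * (of_nat n * x)"
      by (simp only: distrib_right mult.assoc of_int_add of_int_mult of_int_of_nat_eq)
    then have "of_int k * x = of_nat m * x + of_int (k div int n) * (of_nat n * x)"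
      by (simp only: k)
    then have "of_nat m * x = of_int k * x + - (of_int (k div int n) * (of_nat n * x))"
      by simp
    also have "\<dots> \<in> H"
      by (intro H_add H_minus H_int that n(2))
    finally show False using least m by blast
  qed
  define \<theta> where "\<theta> k = cis (2 * pi * real_of_int k / real n)" for k
  have \<theta>_add: "\<theta> (k + l) = \<theta> k * \<theta> l" for k l
    by (simp add: \<theta>_def cis_mult add_divide_distrib distrib_left)
  have \<theta>_period: "\<theta> (k * int n) = 1" for k
  proof -
    have "2 * pi * real_of_int (k * int n) / real n = 2 * pi * real_of_int k"
      using n(1) by simp
    then show ?thesis by (simp add: \<theta>_def cis_multiple_2pi)
  qed
  define coord where "coord y = (SOME k::int. \<exists>h\<in>H. y = h + of_int k * x)" for y
  have \<theta>_eq: "\<theta> (coord y) = \<theta> k" if "h \<in> H" "y = h + of_int k * x" for y h k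
  proof -
    obtain h' where h': "h' \<in> H" "y = h' + of_int (coord y) * x"
      using someI_ex[OF span[of y]] unfolding coord_def by blast
    have "of_int (coord y - k) * x = h + - h'"
      using h'(2) that(2) by (simp add: algebra_simps)
    also have "\<dots> \<in> H" by (intro H_add H_minus that(1) h'(1))
    finally have "int n dvd coord y - k" by (rule period)
    then obtain q where "coord y - k = int n * q" by (rule dvdE)
    then have "coord y = k + q * int n" by (simp add: algebra_simps)
    then show ?thesis by (simp only: \<theta>_add \<theta>_period mult_1_right)
  qed
  define \<chi> where "\<chi> y = \<theta> (coord y)" for y
  have "add_character \<chi>"
    unfolding add_character_def
  proof (intro conjI allI)
    show "\<chi> a \<noteq> 0" for a by (simp add: \<chi>_def \<theta>_def)
    fix a b
    obtain h k h' k' where "h \<in> H" "a = h + of_int k * x" "h' \<in> H" "b = h' + of_int k' * x"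
      using span[of a] span[of b] by blast
    moreover from this have "h + h' \<in> H" "a + b = (h + h') + of_int (k + k') * x"
      by (auto simp: H_add algebra_simps)
    ultimately show "\<chi> (a + b) = \<chi> a * \<chi> b"
      using \<theta>_eq[of h a k] \<theta>_eq[of h' b k'] \<theta>_eq[of "h + h'" "a + b" "k + k'"]
      by (simp add: \<chi>_def \<theta>_add)
  qed
  moreover have "\<chi> h = 1" if "h \<in> H" for h
    using \<theta>_eq[of h h 0] that by (simp add: \<chi>_def \<theta>_def)
  moreover have "\<chi> x \<noteq> 1"
  proof
    assume "\<chi> x = 1"
    then have "cis (2 * pi / real n) = 1"
      using \<theta>_eq[of 0 x 1] H_0 by (simp add: \<chi>_def \<theta>_def)
    then have "cos (2 * pi / real n) = 1"
      by (metis cis.sel(1) one_complex.sel(1))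
    then obtain j :: int where "2 * pi / real n = of_int j * 2 * pi"
      by (auto simp: cos_one_2pi_int)
    then have "real_of_int j * real n = 1" using n(1) by (simp add: field_simps)
    then have "real_of_int (j * int n) = real_of_int 1" by simp
    then have "j * int n = 1" by (simp only: of_int_eq_iff)
    then have "int n dvd 1" by (metis dvd_triv_right)
    then show False using n1 by simp
  qed
  ultimately show ?thesis
    using H(2) by (intro exI[of _ \<chi>]) (auto simp: char_ker_def)
qed


section \<open>Counting the arrows between the modules of two orbits\<close>

text \<open>
  If the orbit representatives are the translates of \<open>\<chi>\<close> by \<open>v\<close> and of \<open>\<chi>'\<close> by \<open>v'\<close>, then
  \<open>w = v v'\<^sup>-\<^sup>1\<close>.
\<close>

lemma arrow_exists:
  fixes \<mm> :: "'r::{finite,comm_ring_1} set"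
  assumes loc: "local_ring_with \<mm>" and p: "p \<in> \<mm> - ideal_square \<mm>"
    and \<chi>: "add_character \<chi>" "mult_character_on (char_stab \<chi>) \<rho>"
    and \<chi>': "add_character \<chi>'" "mult_character_on (char_stab \<chi>') \<rho>'"
    and \<eta>: "\<eta> \<in> char_orbit \<chi>" and \<eta>': "\<eta>' \<in> char_orbit \<chi>'"
    and ann: "\<forall>a\<in>annihilator p. 1 + a \<in> char_stab \<eta> \<and> \<rho> (1 + a) = 1"
    and eq: "\<forall>a. \<eta>' (p * a) = \<eta> a" and rho: "\<forall>u\<in>char_stab \<eta>'. \<rho> u = \<rho>' u"
  shows "\<exists>w. arrow \<chi> \<rho> \<chi>' \<rho>' p w"
proof -
  obtain v where v: "v dvd 1" "\<eta> = (\<lambda>a. \<chi> (v * a))"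
    using \<eta> by (auto simp: char_orbit_def)
  obtain v' where v': "v' dvd 1" "\<eta>' = (\<lambda>a. \<chi>' (v' * a))"
    using \<eta>' by (auto simp: char_orbit_def)
  have stab: "char_stab \<eta> = char_stab \<chi>" "char_stab \<eta>' = char_stab \<chi>'"
    unfolding v(2) v'(2) by (intro char_stab_translate v(1) v'(1))+
  have "arrow \<chi> \<rho> \<chi>' \<rho>' p (v * unit_inv v')"
  proof
    show "add_character \<chi>" "mult_character_on (char_stab \<chi>) \<rho>"
      "add_character \<chi>'" "mult_character_on (char_stab \<chi>') \<rho>'" by fact+
    show "v * unit_inv v' dvd 1"
      using v(1) v'(1) by (simp add: unit_mult_iff unit_inv_unit)
    show "\<chi>' (p * x) = \<chi> (v * unit_inv v' * x)" for x
    proof -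
      have "v' * (p * (unit_inv v' * x)) = (v' * unit_inv v') * (p * x)"
        by (simp only: mult_ac)
      then have "v' * (p * (unit_inv v' * x)) = p * x"
        by (simp add: unit_inv_right v'(1))
      then show ?thesis
        using eq[rule_format, of "unit_inv v' * x"] by (simp only: v(2) v'(2) mult.assoc)
    qed
    show "1 + a \<in> char_stab \<chi> \<and> \<rho> (1 + a) = 1" if "a * p = 0" for a
      using ann that by (simp add: annihilator_def stab)
    show "\<rho> u = \<rho>' u" if "u \<in> char_stab \<chi>'" for u
      using rho that by (simp add: stab)
    show "\<not> p dvd 1"
      using p local_nonunits[OF loc] by blast
    show "a * b \<noteq> e * p" if "\<not> a dvd 1" "\<not> b dvd 1" "e dvd 1" for a b e
    proof
      assume "a * b = e * p"
      then have "unit_inv e * (a * b) = unit_inv e * e * p" by (simp only: mult.assoc)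
      also have "\<dots> = p" using that(3) by (simp add: unit_inv_left)
      finally have "p \<in> ideal_square \<mm>"
        using ideal_square_product[of a \<mm> b "unit_inv e"] that local_nonunits[OF loc] by metis
      with p show False by blast
    qed
  qed
  then show ?thesis by blast
qed

text \<open>
  The map \<open>x \<mapsto> p\<^sub>j x\<close> acts as zero on both modules. A combination of the cocycles that is a
  coboundary is therefore constant on \<open>W\<close> at this map, and the constant is its value \<open>0\<close> at \<open>0\<close>. Only the cocycle
  with index \<open>j\<close> survives, and it is nonzero there.
\<close>

lemma arrows_independent:
  fixes p :: "nat \<Rightarrow> 'r::{finite,comm_ring_1}"
  assumes "finite I"
    and arrows: "\<And>i. i \<in> I \<Longrightarrow> arrow \<chi> \<rho> \<chi>' \<rho>' (p i) (w i)"
    and distinct: "\<And>i j. i \<in> I \<Longrightarrow> j \<in> I \<Longrightarrow> associates (p i) (p j) \<Longrightarrow> i = j"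
    and \<chi>: "add_character \<chi>" "mult_character_on (char_stab \<chi>) \<rho>"
    and \<chi>': "add_character \<chi>'" "mult_character_on (char_stab \<chi>') \<rho>'"
  shows "enat (card I) \<le> ext1_dim (W_module \<chi> \<rho>) (W_module \<chi>' \<rho>')"
proof -
  interpret A: affine_rep \<chi> \<rho> by unfold_locales fact+
  interpret B: affine_rep \<chi>' \<rho>' by unfold_locales fact+
  define E where "E i = arrow.D \<chi>' (p i) (w i)" for i
  show ?thesis
  proof (rule card_le_ext1_dim[OF \<open>finite I\<close>])
    show "module_cocycle A.W B.W (E i)" if "i \<in> I" for i
    proof -
      interpret arrow \<chi> \<rho> \<chi>' \<rho>' "p i" "w i" by (rule arrows[OF that])
      show ?thesis unfolding E_def by (rule module_cocycle_axioms)
    qed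
    show "left_module A.W" "left_module B.W"
      by (rule A.W_left_module B.W_left_module)+
  next
    fix c \<phi>
    assume rel: "\<And>g x. x \<in> car A.W \<Longrightarrow>
      (\<Sum>i\<in>I. act B.W (Poly_Mapping.single 0 (c i)) (E i g x)) + \<phi> (act A.W (Poly_Mapping.single g 1) x)
        = act B.W (Poly_Mapping.single g 1) (\<phi> x)"
    show "\<forall>i\<in>I. c i = 0"
    proof
      fix j assume j: "j \<in> I"
      interpret J: arrow \<chi> \<rho> \<chi>' \<rho>' "p j" "w j" by (rule arrows[OF j])
      define g where "g = Aff (p j) 0"
      have g: "g \<notin> aff_units" using J.p_nonunit by (simp add: g_def aff_units_iff)
      have E_other: "E i g x = 0" if "i \<in> I" "i \<noteq> j" "x \<in> car A.W" for i x
      proof -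
        interpret arrow \<chi> \<rho> \<chi>' \<rho>' "p i" "w i" by (rule arrows[OF that(1)])
        have "\<not> (\<exists>e. e dvd 1 \<and> slope g = e * p i)"
          using distinct[OF j that(1)] that(2) by (auto simp: g_def associates_def)
        then show ?thesis unfolding E_def by (intro D_eq_zero that(3))
      qed
      have E_j: "E j g x \<in> car B.W" if "x \<in> car A.W" for x
        unfolding E_def by (rule J.D_in[OF that])
      have sum: "(\<Sum>i\<in>I. act B.W (Poly_Mapping.single 0 (c i)) (E i g x))
          = act B.W (Poly_Mapping.single 0 (c j)) (E j g x)" if "x \<in> car A.W" for x
        using \<open>finite I\<close> j E_other[OF _ _ that]
        by (subst sum.remove[OF _ j]) (auto simp: act_zero_right[OF B.W_left_module])
      have rel_g: "act B.W (Poly_Mapping.single 0 (c j)) (E j g x) + \<phi> 0 = 0" if "x \<in> car A.W" for x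
        using rel[OF that, of g] by (simp only: sum[OF that] A.act_W_nonunit[OF g] B.act_W_nonunit[OF g])
      have "E j g 0 = 0"
        unfolding E_def using J.D_linear(1)[OF A.W_zero A.W_zero, of g] by simp
      then have "\<phi> 0 = 0"
        using rel_g[OF A.W_zero] by (simp add: act_zero_right[OF B.W_left_module])
      obtain f u where f: "f \<in> car A.W" and u: "u dvd 1" "A.fun_of f u \<noteq> 0"
        using A.exists_nonzero_val by blast
      \<comment> \<open>Chosen such that the cocycle reads off the value of \<open>f\<close> at \<open>u\<close>.\<close>
      define d where "d = unit_inv (w j) * u"
      have d: "d dvd 1"
        using u(1) J.w_unit by (simp add: d_def unit_mult_iff unit_inv_unit)
      have wd: "w j * d * 1 = u"
        using unit_inv_right[OF J.w_unit] by (simp add: d_def flip: mult.assoc)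
      have "B.fun_of (E j g f) d = \<chi>' (d * shift g) * A.fun_of f (w j * d * 1)"
        unfolding E_def by (rule J.D_val[OF f d]) (simp_all add: g_def)
      then have "B.fun_of (E j g f) d \<noteq> 0"
        using u(2) B.char_nonzero by (simp add: wd[simplified])
      moreover have "c j * B.fun_of (E j g f) d = 0"
        using rel_g[OF f] \<open>\<phi> 0 = 0\<close> B.fun_of_scale[OF E_j[OF f] d, of "c j"] by (simp add: B.fun_of_zero)
      ultimately show "c j = 0" by simp
    qed
  qed
qed

theorem theorem3p4:
  fixes \<mm> :: "'r::{finite, comm_ring_1} set"
    and p :: "nat \<Rightarrow> 'r" and r :: nat
  assumes "local_ring_with \<mm>" and "\<mm> \<noteq> {0}"
    and "\<forall>i\<in>{1..r}. p i \<in> \<mm> - ideal_square \<mm>"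
    and "\<forall>q\<in>\<mm> - ideal_square \<mm>. \<exists>!i. i \<in> {1..r} \<and> associates q (p i)"
  shows
    "((\<exists>\<chi>. add_character \<chi> \<and> \<mm> \<subseteq> char_ker \<chi> \<and> char_ker \<chi> \<noteq> UNIV) \<and>
      (\<forall>\<chi>. add_character \<chi> \<and> \<mm> \<subseteq> char_ker \<chi> \<and> char_ker \<chi> \<noteq> UNIV \<longrightarrow>
         1 \<le> gabriel_arrows (trivial_module :: ('r aff \<Rightarrow>\<^sub>0 complex, complex) lmodule)
               (W_module \<chi> (\<lambda>_. 1))))
     \<and>
     (\<forall>\<chi> \<chi>' i. i \<in> {1..r} \<and> add_character \<chi> \<and> add_character \<chi>' \<and> (\<forall>a. \<chi>' (p i * a) = \<chi> a)
         \<longrightarrow> char_stab \<chi>' \<subseteq> char_stab \<chi>)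
     \<and>
     (\<forall>\<chi> \<rho> \<chi>' \<rho>'.
        add_character \<chi> \<and> mult_character_on (char_stab \<chi>) \<rho> \<and>
        add_character \<chi>' \<and> mult_character_on (char_stab \<chi>') \<rho>' \<longrightarrow>
        enat (card {i \<in> {1..r}. \<exists>\<eta>\<in>char_orbit \<chi>. \<exists>\<eta>'\<in>char_orbit \<chi>'.
                annihilator (p i) \<subseteq> char_ker \<eta> \<and>
                (\<forall>a\<in>annihilator (p i). 1 + a \<in> char_stab \<eta> \<and> \<rho> (1 + a) = 1) \<and>
                (\<forall>a. \<eta>' (p i * a) = \<eta> a) \<and>
                (\<forall>u\<in>char_stab \<eta>'. \<rho> u = \<rho>' u)})
          \<le> gabriel_arrows (W_module \<chi> \<rho>) (W_module \<chi>' \<rho>'))"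
proof (intro conjI allI impI)
  show "\<exists>\<chi>. add_character \<chi> \<and> \<mm> \<subseteq> char_ker \<chi> \<and> char_ker \<chi> \<noteq> UNIV"
    using maximal_ideal_of_local[OF assms(1)]
    by (intro exists_character) (simp_all add: is_maximal_ideal_def)
next
  fix \<chi> :: "'r \<Rightarrow> complex"
  assume \<chi>: "add_character \<chi> \<and> \<mm> \<subseteq> char_ker \<chi> \<and> char_ker \<chi> \<noteq> UNIV"
  interpret trivial_arrow \<chi>
  proof
    show "add_character \<chi>" using \<chi> by simp
    show "mult_character_on (char_stab \<chi>) (\<lambda>_. 1)" by (simp add: mult_character_on_def)
    show "\<chi> a = 1" if "\<not> a dvd 1" for a
      using \<chi> that local_nonunits[OF assms(1)] by (auto simp: char_ker_def)
    show "\<exists>b. \<chi> b \<noteq> 1" using \<chi> by (auto simp: char_ker_def)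
  qed
  show "1 \<le> gabriel_arrows (trivial_module :: ('r aff \<Rightarrow>\<^sub>0 complex, complex) lmodule)
      (W_module \<chi> (\<lambda>_. 1))"
    using ext_trivial by (simp add: gabriel_arrows_def trivial_simple W_simple)
next
  fix \<chi> \<chi>' :: "'r \<Rightarrow> complex" and i
  assume h: "i \<in> {1..r} \<and> add_character \<chi> \<and> add_character \<chi>' \<and> (\<forall>a. \<chi>' (p i * a) = \<chi> a)"
  show "char_stab \<chi>' \<subseteq> char_stab \<chi>"
    by (rule char_stab_subset[of 1 _ "p i"]) (use h in simp_all)
next
  fix \<chi> \<rho> \<chi>' \<rho>' :: "'r \<Rightarrow> complex"
  assume h: "add_character \<chi> \<and> mult_character_on (char_stab \<chi>) \<rho> \<and>
    add_character \<chi>' \<and> mult_character_on (char_stab \<chi>') \<rho>'"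
  then interpret A: affine_rep \<chi> \<rho> by unfold_locales auto
  interpret B: affine_rep \<chi>' \<rho>' using h by unfold_locales auto
  define I where "I = {i \<in> {1..r}. \<exists>\<eta>\<in>char_orbit \<chi>. \<exists>\<eta>'\<in>char_orbit \<chi>'.
                annihilator (p i) \<subseteq> char_ker \<eta> \<and>
                (\<forall>a\<in>annihilator (p i). 1 + a \<in> char_stab \<eta> \<and> \<rho> (1 + a) = 1) \<and>
                (\<forall>a. \<eta>' (p i * a) = \<eta> a) \<and>
                (\<forall>u\<in>char_stab \<eta>'. \<rho> u = \<rho>' u)}"
  have "\<forall>i\<in>I. \<exists>w. arrow \<chi> \<rho> \<chi>' \<rho>' (p i) w"
  proof
    fix i assume "i \<in> I"
    then obtain \<eta> \<eta>' where i: "i \<in> {1..r}" and \<eta>: "\<eta> \<in> char_orbit \<chi>" "\<eta>' \<in> char_orbit \<chi>'"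
      "\<forall>a\<in>annihilator (p i). 1 + a \<in> char_stab \<eta> \<and> \<rho> (1 + a) = 1"
      "\<forall>a. \<eta>' (p i * a) = \<eta> a" "\<forall>u\<in>char_stab \<eta>'. \<rho> u = \<rho>' u"
      unfolding I_def by blast
    from i assms(3) have "p i \<in> \<mm> - ideal_square \<mm>" by blast
    from arrow_exists[OF assms(1) this A.char A.mult_char B.char B.mult_char \<eta>]
    show "\<exists>w. arrow \<chi> \<rho> \<chi>' \<rho>' (p i) w" .
  qed
  from bchoice[OF this] obtain w where w: "\<And>i. i \<in> I \<Longrightarrow> arrow \<chi> \<rho> \<chi>' \<rho>' (p i) (w i)"
    by blast
  have distinct: "i = j" if "i \<in> I" "j \<in> I" "associates (p i) (p j)" for i j
  proof -
    have ij: "i \<in> {1..r}" "j \<in> {1..r}" using that(1,2) unfolding I_def by blast+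
    have "associates (p i) (p i)" unfolding associates_def by (intro exI[of _ 1]) simp
    moreover have "\<exists>!k. k \<in> {1..r} \<and> associates (p i) (p k)"
      using assms(3,4) ij(1) by blast
    ultimately show ?thesis
      using ij that(3) by blast
  qed
  have "enat (card I) \<le> ext1_dim (W_module \<chi> \<rho>) (W_module \<chi>' \<rho>')"
    by (rule arrows_independent[OF _ w distinct A.char A.mult_char B.char B.mult_char]) (simp add: I_def)
  then have "enat (card I) \<le> gabriel_arrows (W_module \<chi> \<rho>) (W_module \<chi>' \<rho>')"
    by (simp add: gabriel_arrows_def A.W_simple B.W_simple)
  then show "enat (card {i \<in> {1..r}. \<exists>\<eta>\<in>char_orbit \<chi>. \<exists>\<eta>'\<in>char_orbit \<chi>'.
                annihilator (p i) \<subseteq> char_ker \<eta> \<and>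
                (\<forall>a\<in>annihilator (p i). 1 + a \<in> char_stab \<eta> \<and> \<rho> (1 + a) = 1) \<and>
                (\<forall>a. \<eta>' (p i * a) = \<eta> a) \<and>
                (\<forall>u\<in>char_stab \<eta>'. \<rho> u = \<rho>' u)})
          \<le> gabriel_arrows (W_module \<chi> \<rho>) (W_module \<chi>' \<rho>')"
    unfolding I_def .
qed

end
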